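(* Let $\mathcal{H}$ be a separable complex Hilbert space, let $T$ be a statistic on $\mathcal{H}$, let $\mathcal{N}$ be the abelian von Neumann algebra generated by $T$, and let $\{\varphi_\theta:\theta\in\Theta\}$ be a family of vector states in $\mathcal{H}$. Suppose that $T$ is sufficient in the sense of Petz for $\{\varphi_\theta:\theta\in\Theta\}$, i.e. there exists a positive normal unital linear map $\alpha\colon\mathbb{B}(\mathcal{H})\to\mathcal{N}$ such that $$\langle\alpha(x)\varphi_\theta,\varphi_\theta\rangle=\langle x\varphi_\theta,\varphi_\theta\rangle\qquad\text{for all }x\in\mathbb{B}(\mathcal{H}),\ \theta\in\Theta.$$ If $\alpha(\mathbb{B}(\mathcal{H}))=\mathcal{N}$, then $T$ is weakly sufficient for $\{\varphi_\theta:\theta\in\Theta\}$.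
   Context: $\mathbb{B}(\mathcal{H})$ is the algebra of all bounded linear operators on $\mathcal{H}$. A vector state is a unit vector $\varphi\in\mathcal{H}$. A version of a vector $\varphi$ is a vector $\widetilde{\varphi}=c\varphi$ with $c\in\mathbb{C}$, $|c|=1$. A (quantum) statistic is a (possibly unbounded) selfadjoint operator $T=\int_{-\infty}^{\infty}\lambda\,e(d\lambda)$ on $\mathcal{H}$, where $e$ is its spectral measure on the Borel sets of $\mathbb{R}$; for a Borel function $\Phi$ on $\mathbb{R}$, $\Phi(T)=\int_{-\infty}^{\infty}\Phi(\lambda)\,e(d\lambda)$ (Borel functional calculus). The von Neumann algebra generated by $T$ is $\mathcal{N}=\{\Phi(T):\Phi\text{ a bounded complex-valued Borel function on }\mathbb{R}\}$. A statistic $T$ is weakly sufficient for $\{\varphi_\theta:\theta\in\Theta\}$ if there exist Borel functions $\Phi_\theta\colon\mathbb{R}\to\mathbb{R}$ ($\theta\in\Theta$), a vector $\chi\in\mathcal{H}$ (which may be taken to be a unit vector; the normalization is inessential), and a version $\widetilde{\varphi}_\theta$ of $\varphi_\theta$ for each $\theta\in\Theta$, such that $\widetilde{\varphi}_\theta=\Phi_\theta(T)\chi$ for all $\theta\in\Theta$ (in particular $\chi$ lies in the domain of each $\Phi_\theta(T)$). *)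

theory Defs
  imports "HOL-Analysis.Analysis"
begin

(* A complex Hilbert space.  The inner product is linear in its first argument; its real part
   is the real inner product of the library, which determines norm and topology. *)
class complex_hilbert = real_inner + banach +
  fixes scaleC :: "complex \<Rightarrow> 'a \<Rightarrow> 'a"  (infixr \<open>*\<^sub>C\<close> 75)
    and cinner :: "'a \<Rightarrow> 'a \<Rightarrow> complex"
  assumes scaleC_add_right: "a *\<^sub>C (x + y) = a *\<^sub>C x + a *\<^sub>C y"
    and scaleC_add_left: "(a + b) *\<^sub>C x = a *\<^sub>C x + b *\<^sub>C x"
    and scaleC_scaleC: "a *\<^sub>C b *\<^sub>C x = (a * b) *\<^sub>C x"
    and scaleC_of_real: "complex_of_real r *\<^sub>C x = r *\<^sub>R x"
    and cinner_add_left: "cinner (x + y) z = cinner x z + cinner y z"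
    and cinner_scaleC_left: "cinner (a *\<^sub>C x) y = a * cinner x y"
    and cinner_commute: "cinner x y = cnj (cinner y x)"
    and Re_cinner: "Re (cinner x y) = inner x y"

definition bounded_operators :: "('h::complex_hilbert \<Rightarrow> 'h) set" where
  "bounded_operators = {A. bounded_linear A \<and> (\<forall>c x. A (c *\<^sub>C x) = c *\<^sub>C A x)}"

definition selfadjoint_bounded :: "('h::complex_hilbert \<Rightarrow> 'h) \<Rightarrow> bool" where
  "selfadjoint_bounded A \<longleftrightarrow>
     A \<in> bounded_operators \<and> (\<forall>x y. cinner (A x) y = cinner x (A y))"

definition positive_operator :: "('h::complex_hilbert \<Rightarrow> 'h) \<Rightarrow> bool" where
  "positive_operator A \<longleftrightarrow>
     A \<in> bounded_operators \<and> (\<forall>x. cinner (A x) x \<in> \<real> \<and> 0 \<le> Re (cinner (A x) x))"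

definition operator_le :: "('h::complex_hilbert \<Rightarrow> 'h) \<Rightarrow> ('h \<Rightarrow> 'h) \<Rightarrow> bool" where
  "operator_le A B \<longleftrightarrow> positive_operator (\<lambda>x. B x - A x)"

definition orthogonal_projection :: "('h::complex_hilbert \<Rightarrow> 'h) \<Rightarrow> bool" where
  "orthogonal_projection P \<longleftrightarrow> selfadjoint_bounded P \<and> P \<circ> P = P"

(* Possibly unbounded operators are partial functions T with domain "dom T"; equality of two
   such operators includes equality of their domains. *)
definition linear_operator :: "('h::complex_hilbert \<rightharpoonup> 'h) \<Rightarrow> bool" where
  "linear_operator T \<longleftrightarrow>
     T 0 = Some 0 \<and>
     (\<forall>x y u v a b. T x = Some u \<and> T y = Some v \<longrightarrow>
        T (a *\<^sub>C x + b *\<^sub>C y) = Some (a *\<^sub>C u + b *\<^sub>C v))"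

definition adjoint_operator :: "('h::complex_hilbert \<rightharpoonup> 'h) \<Rightarrow> ('h \<rightharpoonup> 'h)" where
  "adjoint_operator T y =
     (if \<exists>z. \<forall>x u. T x = Some u \<longrightarrow> cinner u y = cinner x z
      then Some (THE z. \<forall>x u. T x = Some u \<longrightarrow> cinner u y = cinner x z)
      else None)"

definition selfadjoint_operator :: "('h::complex_hilbert \<rightharpoonup> 'h) \<Rightarrow> bool" where
  "selfadjoint_operator T \<longleftrightarrow>
     linear_operator T \<and> closure (dom T) = UNIV \<and> adjoint_operator T = T"

definition projection_valued_measure :: "(real set \<Rightarrow> 'h::complex_hilbert \<Rightarrow> 'h) \<Rightarrow> bool" where
  "projection_valued_measure e \<longleftrightarrow>
     (\<forall>B \<in> sets borel. orthogonal_projection (e B)) \<and>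
     e UNIV = (\<lambda>x. x) \<and>
     (\<forall>B :: nat \<Rightarrow> real set. range B \<subseteq> sets borel \<and> disjoint_family B \<longrightarrow>
        (\<forall>x. (\<lambda>n. e (B n) x) sums e (\<Union>n. B n) x))"

definition vector_measure :: "(real set \<Rightarrow> 'h::complex_hilbert \<Rightarrow> 'h) \<Rightarrow> 'h \<Rightarrow> real measure" where
  "vector_measure e x =
     measure_of UNIV (sets borel) (\<lambda>B. ennreal (Re (cinner (e B x) x)))"

definition simple_integral_vector ::
    "(real set \<Rightarrow> 'h::complex_hilbert \<Rightarrow> 'h) \<Rightarrow> (real \<Rightarrow> complex) \<Rightarrow> 'h \<Rightarrow> 'h" where
  "simple_integral_vector e s x = (\<Sum>c \<in> range s. c *\<^sub>C e (s -` {c}) x)"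

(* The operator  \<integral> f(t) e(dt)  for Borel f.  Its domain consists of the x for which f is
   square-integrable with respect to  B \<mapsto> \<langle>e(B) x, x\<rangle>.  On simple functions the integral is
   isometric from L2 of this measure into the Hilbert space, and it is extended by continuity:
   the value at x is the common limit along all simple functions s n converging to f in L2. *)
definition spectral_integral ::
    "(real set \<Rightarrow> 'h::complex_hilbert \<Rightarrow> 'h) \<Rightarrow> (real \<Rightarrow> complex) \<Rightarrow> ('h \<rightharpoonup> 'h)" where
  "spectral_integral e f x =
     (if (\<integral>\<^sup>+ t. ennreal ((cmod (f t))\<^sup>2) \<partial>vector_measure e x) < \<infinity>
      then Some (THE y. \<forall>s :: nat \<Rightarrow> real \<Rightarrow> complex.
             (\<forall>n. simple_function borel (s n)) \<and>
             (\<lambda>n. \<integral>\<^sup>+ t. ennreal ((cmod (s n t - f t))\<^sup>2) \<partial>vector_measure e x) \<longlonglongrightarrow> 0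
             \<longrightarrow> (\<lambda>n. simple_integral_vector e (s n) x) \<longlonglongrightarrow> y)
      else None)"

definition is_spectral_measure_of ::
    "(real set \<Rightarrow> 'h::complex_hilbert \<Rightarrow> 'h) \<Rightarrow> ('h \<rightharpoonup> 'h) \<Rightarrow> bool" where
  "is_spectral_measure_of e T \<longleftrightarrow>
     projection_valued_measure e \<and> T = spectral_integral e complex_of_real"

(* f(T).  By the spectral theorem a selfadjoint T has a spectral measure, and it is unique on
   Borel sets (on other sets its values are junk, hence SOME rather than THE).  For an operator
   T without spectral measure, f(T) is by convention nowhere defined. *)
definition borel_calculus ::
    "('h::complex_hilbert \<rightharpoonup> 'h) \<Rightarrow> (real \<Rightarrow> complex) \<Rightarrow> ('h \<rightharpoonup> 'h)" where
  "borel_calculus T f =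
     (if \<exists>e. is_spectral_measure_of e T
      then spectral_integral (SOME e. is_spectral_measure_of e T) f
      else Map.empty)"

definition generated_algebra :: "('h::complex_hilbert \<rightharpoonup> 'h) \<Rightarrow> ('h \<Rightarrow> 'h) set" where
  "generated_algebra T =
     {A. \<exists>f. f \<in> borel_measurable borel \<and> bounded (range f) \<and>
           borel_calculus T f = (\<lambda>x. Some (A x))}"

definition is_operator_lub :: "('h::complex_hilbert \<Rightarrow> 'h) set \<Rightarrow> ('h \<Rightarrow> 'h) \<Rightarrow> bool" where
  "is_operator_lub S A \<longleftrightarrow>
     selfadjoint_bounded A \<and> (\<forall>B \<in> S. operator_le B A) \<and>
     (\<forall>C. selfadjoint_bounded C \<and> (\<forall>B \<in> S. operator_le B C) \<longrightarrow> operator_le A C)"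

definition upward_directed :: "('h::complex_hilbert \<Rightarrow> 'h) set \<Rightarrow> bool" where
  "upward_directed S \<longleftrightarrow>
     S \<noteq> {} \<and> (\<forall>A \<in> S. selfadjoint_bounded A) \<and>
     (\<forall>A \<in> S. \<forall>B \<in> S. \<exists>C \<in> S. operator_le A C \<and> operator_le B C)"

definition linear_map :: "(('h::complex_hilbert \<Rightarrow> 'h) \<Rightarrow> ('h \<Rightarrow> 'h)) \<Rightarrow> bool" where
  "linear_map \<alpha> \<longleftrightarrow>
     (\<forall>A \<in> bounded_operators. \<forall>B \<in> bounded_operators. \<forall>a b.
        \<alpha> (\<lambda>x. a *\<^sub>C A x + b *\<^sub>C B x) = (\<lambda>x. a *\<^sub>C \<alpha> A x + b *\<^sub>C \<alpha> B x))"

definition positive_map :: "(('h::complex_hilbert \<Rightarrow> 'h) \<Rightarrow> ('h \<Rightarrow> 'h)) \<Rightarrow> bool" where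
  "positive_map \<alpha> \<longleftrightarrow> (\<forall>A. positive_operator A \<longrightarrow> positive_operator (\<alpha> A))"

(* Normality: suprema of bounded increasing nets of selfadjoint operators are preserved. *)
definition normal_map :: "(('h::complex_hilbert \<Rightarrow> 'h) \<Rightarrow> ('h \<Rightarrow> 'h)) \<Rightarrow> bool" where
  "normal_map \<alpha> \<longleftrightarrow>
     (\<forall>S A. upward_directed S \<and> is_operator_lub S A \<longrightarrow> is_operator_lub (\<alpha> ` S) (\<alpha> A))"

definition unital_map :: "(('h::complex_hilbert \<Rightarrow> 'h) \<Rightarrow> ('h \<Rightarrow> 'h)) \<Rightarrow> bool" where
  "unital_map \<alpha> \<longleftrightarrow> \<alpha> (\<lambda>x. x) = (\<lambda>x. x)"

(* "petz_witness T \<Theta> \<phi> \<alpha>": the map \<alpha> witnesses that T is sufficient in the sense of Petz. *)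
definition petz_witness ::
    "('h::complex_hilbert \<rightharpoonup> 'h) \<Rightarrow> 'i set \<Rightarrow> ('i \<Rightarrow> 'h) \<Rightarrow> (('h \<Rightarrow> 'h) \<Rightarrow> ('h \<Rightarrow> 'h)) \<Rightarrow> bool"
  where
  "petz_witness T \<Theta> \<phi> \<alpha> \<longleftrightarrow>
     \<alpha> ` bounded_operators \<subseteq> generated_algebra T \<and>
     linear_map \<alpha> \<and> positive_map \<alpha> \<and> normal_map \<alpha> \<and> unital_map \<alpha> \<and>
     (\<forall>A \<in> bounded_operators. \<forall>\<theta> \<in> \<Theta>. cinner (\<alpha> A (\<phi> \<theta>)) (\<phi> \<theta>) = cinner (A (\<phi> \<theta>)) (\<phi> \<theta>))"

(* An equation "f(T) \<xi> = Some y" includes that \<xi> lies in the domain of f(T). *)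
definition weakly_sufficient ::
    "('h::complex_hilbert \<rightharpoonup> 'h) \<Rightarrow> 'i set \<Rightarrow> ('i \<Rightarrow> 'h) \<Rightarrow> bool" where
  "weakly_sufficient T \<Theta> \<phi> \<longleftrightarrow>
     (\<exists>(\<Phi> :: 'i \<Rightarrow> real \<Rightarrow> real) (\<xi> :: 'h) (c :: 'i \<Rightarrow> complex). \<forall>\<theta> \<in> \<Theta>.
        \<Phi> \<theta> \<in> borel_measurable borel \<and> cmod (c \<theta>) = 1 \<and>
        borel_calculus T (\<lambda>t. complex_of_real (\<Phi> \<theta> t)) \<xi> = Some (c \<theta> *\<^sub>C \<phi> \<theta>))"

end

(* Let p be the projection onto a vector state \<psi> of the family and A = \<alpha>(p). If \<langle>A \<xi>, \<xi>\<rangle> = \<parallel>\<xi>\<parallel>^2, the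
   positive functional x \<mapsto> \<langle>\<alpha>(x) \<xi>, \<xi>\<rangle> annihilates 1 - p, so it equals \<parallel>\<xi>\<parallel>^2 \<langle>x \<psi>, \<psi>\<rangle>. Invariance
   gives this for \<xi> = \<psi>, and since A commutes with the spectral measure e also for \<xi> = e(C) \<psi>.
   By surjectivity e(C) = \<alpha>(x) for some x, whence \<parallel>e(C) \<psi>\<parallel>^2 is 0 or 1 for every Borel set C. So
   \<psi> is an eigenvector, e({t}) \<psi> = \<psi>, and A is the identity on the range of e({t}).
   Therefore two states with the same t are versions of each other, states with different t are
   orthogonal, and by separability there are countably many t. With an enumeration t_n and
   representatives \<psi>_n, the vector \<chi> = \<Sum> 2^(-n) \<psi>_n and the functions 2^n 1_{t_n} do the job. *)
theory Submission
  imports Defs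
begin

section \<open>Algebra of the complex inner product and of complex scalars\<close>

lemma cinner_zero_left [simp]: "cinner 0 (y::'h::complex_hilbert) = 0"
  using cinner_add_left[of 0 0 y] by simp

lemma cinner_zero_right [simp]: "cinner (y::'h::complex_hilbert) 0 = 0"
  using cinner_commute[of y 0] by simp

lemma cinner_add_right: "cinner (x::'h::complex_hilbert) (y + z) = cinner x y + cinner x z"
  by (metis cinner_add_left cinner_commute complex_cnj_add)

lemma cinner_scaleC_right: "cinner (x::'h::complex_hilbert) (a *\<^sub>C y) = cnj a * cinner x y"
  by (metis cinner_commute cinner_scaleC_left complex_cnj_mult)

lemma cinner_scaleR_left: "cinner (r *\<^sub>R x) (y::'h::complex_hilbert) = of_real r * cinner x y"
  by (metis cinner_scaleC_left scaleC_of_real)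

lemma cinner_scaleR_right: "cinner (x::'h::complex_hilbert) (r *\<^sub>R y) = of_real r * cinner x y"
  by (metis cinner_scaleC_right scaleC_of_real complex_cnj_complex_of_real)

lemma cinner_minus_left: "cinner (- x) (y::'h::complex_hilbert) = - cinner x y"
  using cinner_scaleR_left[of "-1" x y] by simp

lemma cinner_minus_right: "cinner x (- y::'h::complex_hilbert) = - cinner x y"
  using cinner_scaleR_right[of x "-1" y] by simp

lemma cinner_diff_left: "cinner (x - y) (z::'h::complex_hilbert) = cinner x z - cinner y z"
  using cinner_add_left[of x "-y" z] by (simp add: cinner_minus_left)

lemma cinner_diff_right: "cinner z (x - y::'h::complex_hilbert) = cinner z x - cinner z y"
  using cinner_add_right[of z x "-y"] by (simp add: cinner_minus_right)

lemmas cinner_simps = cinner_add_left cinner_add_right cinner_diff_left cinner_diff_right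
  cinner_scaleC_left cinner_scaleC_right cinner_scaleR_left cinner_scaleR_right

lemma cinner_self: "cinner (x::'h::complex_hilbert) x = of_real ((norm x)\<^sup>2)"
proof -
  have "Im (cinner x x) = 0"
    using arg_cong[OF cinner_commute[of x x], of Im] by simp
  then show ?thesis
    by (simp add: complex_eq_iff Re_cinner power2_norm_eq_inner)
qed

lemma scaleC_zero_left [simp]: "0 *\<^sub>C (x::'h::complex_hilbert) = 0"
  using scaleC_of_real[of 0 x] by simp

lemma scaleC_one [simp]: "1 *\<^sub>C (x::'h::complex_hilbert) = x"
  using scaleC_of_real[of 1 x] by simp

lemma scaleC_zero_right [simp]: "a *\<^sub>C (0::'h::complex_hilbert) = 0"
  using scaleC_add_right[of a 0 "0::'h"] by simp

lemma scaleC_minus_one [simp]: "(-1) *\<^sub>C (x::'h::complex_hilbert) = - x"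
  using scaleC_of_real[of "-1" x] by simp

lemma scaleC_minus_left [simp]: "(- a) *\<^sub>C (x::'h::complex_hilbert) = - (a *\<^sub>C x)"
  by (metis add_eq_0_iff2 add.left_inverse scaleC_add_left scaleC_zero_left)

lemma scaleC_diff_left: "(a - b) *\<^sub>C (x::'h::complex_hilbert) = a *\<^sub>C x - b *\<^sub>C x"
  using scaleC_add_left[of a "-b" x] by simp

lemma scaleC_diff_right: "a *\<^sub>C (x - y::'h::complex_hilbert) = a *\<^sub>C x - a *\<^sub>C y"
  by (metis add_diff_cancel_right' diff_add_cancel scaleC_add_right)

lemma scaleC_sum_right: "a *\<^sub>C (\<Sum>i\<in>F. f i :: 'h::complex_hilbert) = (\<Sum>i\<in>F. a *\<^sub>C f i)"
  by (induction F rule: infinite_finite_induct) (auto simp: scaleC_add_right)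

lemma norm_scaleC: "norm (a *\<^sub>C (x::'h::complex_hilbert)) = cmod a * norm x"
proof -
  have "complex_of_real ((norm (a *\<^sub>C x))\<^sup>2) = of_real ((cmod a * norm x)\<^sup>2)"
    unfolding cinner_self[symmetric]
    by (simp add: cinner_simps cinner_self[of x] power_mult_distrib complex_norm_square del: of_real_power)
  then have "(norm (a *\<^sub>C x))\<^sup>2 = (cmod a * norm x)\<^sup>2" 
    using of_real_eq_iff by blast
  then show ?thesis by (simp add: power2_eq_iff_nonneg)
qed

text \<open>Rotating \<open>x\<close> by a phase \<open>u\<close> turns the complex inner product
  into its modulus, which is then a real inner product, and the real Cauchy-Schwarz inequality
  applies.\<close>

lemma norm_cinner_le: "cmod (cinner (x::'h::complex_hilbert) y) \<le> norm x * norm y"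
proof -
  define u where "u = (if cinner x y = 0 then 1 else cnj (sgn (cinner x y)))"
  have u: "cmod u = 1" by (simp add: u_def norm_sgn)
  have "cinner (u *\<^sub>C x) y = cmod (cinner x y)"
    by (auto simp: u_def cinner_simps sgn_eq complex_norm_square[symmetric] power2_eq_square divide_simps
        mult.commute)
  then have "cmod (cinner x y) = inner (u *\<^sub>C x) y" 
    by (metis Re_cinner Re_complex_of_real)
  also have "\<dots> \<le> norm (u *\<^sub>C x) * norm y" by (rule norm_cauchy_schwarz)
  finally show ?thesis by (simp add: norm_scaleC u)
qed

section \<open>Bounded linear maps and bounded operators\<close>

lemma bounded_linear_cinner_left: "bounded_linear (\<lambda>x::'h::complex_hilbert. cinner x y)"
  by (rule bounded_linear_intro[where K = "norm y"])
     (auto simp: cinner_simps norm_cinner_le scaleR_conv_of_real)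

lemma bounded_linear_scaleC: "bounded_linear (\<lambda>x::'h::complex_hilbert. a *\<^sub>C x)"
  by (rule bounded_linear_intro[where K = "cmod a"])
     (simp_all add: scaleC_add_right norm_scaleC mult.commute flip: scaleC_of_real scaleC_scaleC,
      simp add: scaleC_scaleC mult.commute)

lemma bounded_linear_scaleC_left: "bounded_linear (\<lambda>a. a *\<^sub>C (x::'h::complex_hilbert))"
  by (rule bounded_linear_intro[where K = "norm x"])
     (simp_all add: scaleC_add_left norm_scaleC scaleR_conv_of_real flip: scaleC_of_real scaleC_scaleC)

lemma bounded_operatorsD:
  assumes "A \<in> bounded_operators"
  shows "bounded_linear A" "A (c *\<^sub>C x) = c *\<^sub>C A x"
  using assms by (auto simp: bounded_operators_def)

lemma bounded_operators_lincomb: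
  assumes "A \<in> bounded_operators" "B \<in> bounded_operators"
  shows "(\<lambda>x. a *\<^sub>C A x + b *\<^sub>C B x) \<in> bounded_operators"
  using assms bounded_linear_compose[OF bounded_linear_scaleC, of A]
    bounded_linear_compose[OF bounded_linear_scaleC, of B]
  by (auto simp: bounded_operators_def scaleC_add_right scaleC_scaleC mult.commute
      intro!: bounded_linear_add)

lemma bounded_operators_id: "(\<lambda>x. x) \<in> bounded_operators"
  by (simp add: bounded_operators_def bounded_linear_ident)

subsection \<open>Riesz representation and adjoints\<close>

text \<open>The functional \<open>J\<close> is bounded below, a minimizing sequence is Cauchy by the
  parallelogram law, and at a minimizer \<open>z\<close> the first variation vanishes. If
  \<open>f\<close> is the inner product with \<open>z\<close>, then \<open>J x\<close> is the
  squared distance from \<open>x\<close> to \<open>z\<close> minus the squared norm of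
  \<open>z\<close>, so the minimizer is the representing vector.\<close>

lemma riesz_representation_real:
  fixes f :: "'h::{real_inner,banach} \<Rightarrow> real"
  assumes "bounded_linear f"
  obtains z where "\<And>x. f x = inner x z"
proof -
  interpret f: bounded_linear f by fact
  define J where "J x = (norm x)\<^sup>2 - 2 * f x" for x
  obtain K where K: "\<And>x. norm (f x) \<le> norm x * K" using f.bounded by blast
  have low: "- (K\<^sup>2) \<le> J x" for x
  proof -
    have "f x \<le> norm x * K" using K[of x] by simp
    then show ?thesis using zero_le_power2[of "norm x - K"] by (simp add: J_def power2_eq_square algebra_simps)
  qed
  define m where "m = Inf (range J)"
  have bdd: "bdd_below (range J)" using low by (rule bdd_belowI2)
  have mJ: "m \<le> J x" for x unfolding m_def using bdd by (simp add: cInf_lower)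
  have "\<exists>x. J x < m + 1 / real (Suc n)" for n
  proof -
    have "Inf (range J) < m + 1 / real (Suc n)" by (simp add: m_def)
    then show ?thesis using cInf_less_iff[of "range J"] bdd by auto
  qed
  then obtain X where X: "\<And>n. J (X n) < m + 1 / real (Suc n)" by metis
  \<comment> \<open>Parallelogram law: the midpoint of \<open>a\<close> and \<open>b\<close> has
    \<open>J\<close>-value at least \<open>m\<close>, so near-minimizers are close to each
    other.\<close>
  have par: "(norm (a - b))\<^sup>2 \<le> 2 * (J a - m) + 2 * (J b - m)" for a b
  proof -
    have "(norm (a - b))\<^sup>2 = 2 * J a + 2 * J b - 4 * J ((1/2) *\<^sub>R (a + b))"
      by (simp add: J_def f.scaleR f.add power2_norm_eq_inner inner_simps inner_commute algebra_simps)
    then show ?thesis using mJ[of "(1/2) *\<^sub>R (a + b)"] by simp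
  qed
  have "Cauchy X"
  proof (rule metric_CauchyI)
    fix \<epsilon> :: real assume "\<epsilon> > 0"
    then obtain N where N: "1 / real (Suc N) < \<epsilon>\<^sup>2 / 4"
      using reals_Archimedean[of "\<epsilon>\<^sup>2 / 4"] by (auto simp: inverse_eq_divide)
    have small: "J (X n) - m < \<epsilon>\<^sup>2 / 4" if "n \<ge> N" for n
    proof -
      have "1 / real (Suc n) \<le> 1 / real (Suc N)" using that by (simp add: field_simps)
      then show ?thesis using X[of n] N by linarith
    qed
    have "dist (X a) (X b) < \<epsilon>" if "a \<ge> N" "b \<ge> N" for a b
    proof -
      have "2 * (J (X a) - m) + 2 * (J (X b) - m) < \<epsilon>\<^sup>2" 
        using small[OF that(1)] small[OF that(2)] by (simp add: field_simps)
      with par have "(norm (X a - X b))\<^sup>2 < \<epsilon>\<^sup>2" by (rule order.strict_trans1)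
      then show ?thesis using \<open>\<epsilon> > 0\<close> by (simp add: dist_norm power_less_imp_less_base)
    qed
    then show "\<exists>M. \<forall>a\<ge>M. \<forall>b\<ge>M. dist (X a) (X b) < \<epsilon>" by blast
  qed
  then obtain z where z: "X \<longlonglongrightarrow> z" by (auto simp: Cauchy_convergent_iff convergent_def)
  have "(\<lambda>n. J (X n)) \<longlonglongrightarrow> J z"
    unfolding J_def by (intro tendsto_intros f.tendsto z)
  moreover have "(\<lambda>n. m + 1 / real (Suc n)) \<longlonglongrightarrow> m + 0"
    by (intro tendsto_intros LIMSEQ_Suc[OF lim_1_over_n])
  ultimately have "J z \<le> m + 0"
    by (rule LIMSEQ_le) (use X less_imp_le in blast)
  then have min: "J z \<le> J x" for x using mJ[of x] by simp
  have "f x = inner x z" for x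
  proof (rule ccontr)
    assume ne: "f x \<noteq> inner x z"
    define d where "d = f x - inner x z"
    \<comment> \<open>A step in direction \<open>x\<close> of this length would lower
      \<open>J\<close> strictly unless \<open>d = 0\<close>; the summand 1 keeps the denominator
      positive for \<open>x = 0\<close>.\<close>
    define s where "s = d / ((norm x)\<^sup>2 + 1)"
    have "J (z + s *\<^sub>R x) = J z + s\<^sup>2 * (norm x)\<^sup>2 - 2 * s * d"
      by (simp add: J_def d_def f.add f.scaleR power2_norm_eq_inner inner_simps inner_commute
          power2_eq_square[of s] algebra_simps)
    then have "2 * s * d \<le> s\<^sup>2 * (norm x)\<^sup>2" using min[of "z + s *\<^sub>R x"] by simp
    moreover have "s * d = s\<^sup>2 * ((norm x)\<^sup>2 + 1)"
    proof -
      have "(norm x)\<^sup>2 + 1 \<noteq> 0" by (smt (verit) zero_le_power2)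
      then show ?thesis by (simp add: s_def power2_eq_square)
    qed
    ultimately have "s\<^sup>2 * (norm x)\<^sup>2 + 2 * s\<^sup>2 \<le> 0" by (simp add: algebra_simps)
    then have "s = 0" 
      by (smt (verit) mult_nonneg_nonneg zero_le_power2 zero_less_power2)
    moreover have "(norm x)\<^sup>2 + 1 \<noteq> 0" by (smt (verit) zero_le_power2)
    ultimately show False using ne by (simp add: s_def d_def)
  qed
  then show ?thesis by (rule that)
qed

text \<open>The real Riesz representation gives the identity for real parts; replacing
  \<open>x\<close> by \<i> times \<open>x\<close> yields the imaginary parts.\<close>

lemma adjoint_exists:
  fixes A :: "'h::complex_hilbert \<Rightarrow> 'h"
  assumes "A \<in> bounded_operators"
  obtains B where "B \<in> bounded_operators" "\<And>x y. cinner (A x) y = cinner x (B y)"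
proof -
  interpret A: bounded_linear A using assms by (simp add: bounded_operators_def)
  have "\<exists>z. \<forall>x. cinner (A x) y = cinner x z" for y
  proof -
    have "bounded_linear (\<lambda>x. inner (A x) y)"
      by (rule bounded_linear_compose[OF bounded_linear_inner_left A.bounded_linear_axioms])
    then obtain z where z: "\<And>x. inner (A x) y = inner x z"
      using riesz_representation_real by blast
    have "cinner (A x) y = cinner x z" for x
    proof (rule complex_eqI)
      show "Re (cinner (A x) y) = Re (cinner x z)" by (simp add: Re_cinner z)
      have "Re (cinner (A (\<i> *\<^sub>C x)) y) = Re (cinner (\<i> *\<^sub>C x) z)" by (simp add: Re_cinner z)
      then show "Im (cinner (A x) y) = Im (cinner x z)"
        by (simp add: bounded_operatorsD[OF assms] cinner_simps)
    qed
    then show ?thesis by blast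
  qed
  then obtain B where B: "\<And>x y. cinner (A x) y = cinner x (B y)" by metis
  have eqI: "u = v" if "\<And>x. cinner x u = cinner x v" for u v :: 'h
  proof -
    have "cinner (u - v) (u - v) = 0" using that[of "u - v"] by (simp add: cinner_diff_right)
    then show ?thesis by (simp add: cinner_self)
  qed
  obtain K where K: "K > 0" "\<And>x. norm (A x) \<le> norm x * K" using A.pos_bounded by blast
  have add: "B (x + y) = B x + B y" for x y
    by (rule eqI) (simp add: cinner_add_right flip: B)
  have sc: "B (c *\<^sub>C x) = c *\<^sub>C B x" for c x
    by (rule eqI) (simp add: cinner_scaleC_right flip: B)
  have "norm (B y) \<le> norm y * K" for y
  proof -
    have "(norm (B y))\<^sup>2 = cmod (cinner (B y) (B y))" by (simp add: cinner_self norm_power)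
    also have "\<dots> = cmod (cinner (A (B y)) y)" by (simp add: B)
    also have "\<dots> \<le> norm (B y) * K * norm y" 
      using norm_cinner_le K by (meson mult_right_mono norm_ge_zero order_trans)
    finally have "norm (B y) * norm (B y) \<le> norm (B y) * (norm y * K)" 
      by (simp add: power2_eq_square mult_ac)
    then show ?thesis using K(1) by (cases "B y = 0") auto
  qed
  then have "bounded_linear B"
    by (intro bounded_linear_intro[where K = K] add) (auto simp: sc simp flip: scaleC_of_real)
  then have "B \<in> bounded_operators" using sc by (simp add: bounded_operators_def)
  then show ?thesis using B that by blast
qed

subsection \<open>Spectral integrals\<close>

locale pvm =
  fixes e :: "real set \<Rightarrow> 'h::complex_hilbert \<Rightarrow> 'h"
  assumes pvm: "projection_valued_measure e"
begin

lemma e_bounded_operator: "B \<in> sets borel \<Longrightarrow> e B \<in> bounded_operators"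
  using pvm by (simp add: projection_valued_measure_def orthogonal_projection_def selfadjoint_bounded_def)

lemma e_bounded_linear: "B \<in> sets borel \<Longrightarrow> bounded_linear (e B)"
  using e_bounded_operator bounded_operatorsD by blast

lemmas e_linear = bounded_linear.linear[OF e_bounded_linear]

lemma e_selfadjoint: "B \<in> sets borel \<Longrightarrow> cinner (e B x) y = cinner x (e B y)"
  using pvm by (simp add: projection_valued_measure_def orthogonal_projection_def selfadjoint_bounded_def)

lemma e_idem: "B \<in> sets borel \<Longrightarrow> e B (e B x) = e B x"
  using pvm by (auto simp: projection_valued_measure_def orthogonal_projection_def fun_eq_iff)

lemma e_UNIV [simp]: "e UNIV = (\<lambda>x. x)"
  using pvm by (simp add: projection_valued_measure_def)

lemma e_sums:
  fixes B :: "nat \<Rightarrow> real set"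
  assumes "range B \<subseteq> sets borel" "disjoint_family B"
  shows "(\<lambda>n. e (B n) x) sums e (\<Union>n. B n) x"
  using pvm assms by (auto simp: projection_valued_measure_def)

text \<open>The constant sequence of empty sets is disjoint, and a series with constant terms
  converges only if the term is zero.\<close>

lemma e_empty [simp]: "e {} x = 0"
proof -
  have "(\<lambda>n::nat. e {} x) sums e (\<Union>n::nat. {}) x"
    by (rule e_sums) (auto simp: disjoint_family_on_def)
  then have "summable (\<lambda>n::nat. e {} x)" by (rule sums_summable)
  then have "(\<lambda>n::nat. e {} x) \<longlonglongrightarrow> 0" by (rule summable_LIMSEQ_zero)
  then show ?thesis by (simp add: LIMSEQ_const_iff)
qed

lemma e_Un:
  assumes "A \<in> sets borel" "B \<in> sets borel" "A \<inter> B = {}"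
  shows "e (A \<union> B) x = e A x + e B x"
proof -
  have "(\<lambda>n. e (binaryset A B n) x) sums e (\<Union>n. binaryset A B n) x"
    using assms by (intro e_sums) (auto simp: binaryset_def disjoint_family_on_def)
  moreover have "(\<lambda>n. e (binaryset A B n) x) sums (e A x + e B x)"
    by (rule binaryset_sums[where f = "\<lambda>S. e S x"]) simp
  ultimately show ?thesis by (simp add: UN_binaryset_eq sums_unique2)
qed

lemma cinner_e: "B \<in> sets borel \<Longrightarrow> cinner (e B x) x = of_real ((norm (e B x))\<^sup>2)"
  by (metis cinner_self e_idem e_selfadjoint)

text \<open>Pythagoras read backwards: with \<open>y = e B x\<close>, additivity on the disjoint
  union shows that the squared norm of \<open>e A y + y\<close> is the sum of the squared norms.
  Hence the inner product of \<open>e A y\<close> and \<open>y\<close>, which is the squared norm of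
  \<open>e A y\<close>, vanishes.\<close>

lemma e_disjoint:
  assumes "A \<in> sets borel" "B \<in> sets borel" "A \<inter> B = {}"
  shows "e A (e B x) = 0"
proof -
  let ?y = "e B x"
  have "cinner (e (A \<union> B) ?y) ?y = cinner (e A ?y) ?y + cinner (e B ?y) ?y"
    by (simp add: e_Un[OF assms] cinner_simps)
  then have "complex_of_real ((norm (e (A \<union> B) ?y))\<^sup>2) = of_real ((norm (e A ?y))\<^sup>2 + (norm ?y)\<^sup>2)"
    using assms cinner_self[of ?y] by (simp add: cinner_e e_idem)
  then have "(norm (e A ?y + ?y))\<^sup>2 = (norm (e A ?y))\<^sup>2 + (norm ?y)\<^sup>2"
    unfolding of_real_eq_iff by (simp add: e_Un[OF assms] e_idem assms)
  moreover have "(norm (e A ?y + ?y))\<^sup>2 = (norm (e A ?y))\<^sup>2 + (norm ?y)\<^sup>2 + 2 * inner (e A ?y) ?y"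
    by (simp add: power2_norm_eq_inner inner_simps inner_commute)
  ultimately have "inner (e A ?y) ?y = 0" by simp
  then have "(norm (e A ?y))\<^sup>2 = 0"
    using cinner_e[OF assms(1), of ?y] by (metis Re_cinner Re_complex_of_real)
  then show ?thesis by simp
qed

text \<open>Split each set along the intersection; by disjointness the cross terms vanish and only
  the common part survives, where \<open>e\<close> is idempotent.\<close>

lemma e_Int:
  assumes "A \<in> sets borel" "B \<in> sets borel"
  shows "e A (e B x) = e (A \<inter> B) x"
proof -
  note lin = linear_add[OF e_linear]
  have B: "e B x = e (A \<inter> B) x + e (B - A) x"
  proof -
    have "A \<inter> B \<union> (B - A) = B" "A \<inter> B \<inter> (B - A) = {}" by auto
    then show ?thesis using e_Un[of "A \<inter> B" "B - A" x] assms by simp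
  qed
  have A: "e A y = e (A \<inter> B) y + e (A - B) y" for y
  proof -
    have "A \<inter> B \<union> (A - B) = A" "A \<inter> B \<inter> (A - B) = {}" by auto
    then show ?thesis using e_Un[of "A \<inter> B" "A - B" y] assms by simp
  qed
  have "e A (e B x) = e A (e (A \<inter> B) x)"
    unfolding B using assms by (simp add: lin e_disjoint)
  also have "\<dots> = e (A \<inter> B) x"
  proof -
    have "e (A - B) (e (A \<inter> B) x) = 0" using assms by (intro e_disjoint) auto
    then show ?thesis unfolding A using assms by (simp add: e_idem)
  qed
  finally show ?thesis .
qed

lemma e_UN:
  assumes "finite K" "\<And>k. k \<in> K \<Longrightarrow> D k \<in> sets borel" "disjoint_family_on D K"
  shows "e (\<Union>k\<in>K. D k) x = (\<Sum>k\<in>K. e (D k) x)"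
  using assms
proof (induction K)
  case (insert k K)
  have "e (D k \<union> (\<Union>k\<in>K. D k)) x = e (D k) x + e (\<Union>k\<in>K. D k) x"
  proof (rule e_Un)
    show "D k \<inter> (\<Union>k\<in>K. D k) = {}"
      using insert.hyps insert.prems by (auto simp: disjoint_family_on_def)
  qed (use insert in auto)
  then show ?case using insert by (simp add: disjoint_family_on_insert)
qed simp

section \<open>Scalar spectral measures and integrals of simple functions\<close>

abbreviation \<mu> where "\<mu> \<equiv> vector_measure e"

lemma space_vm [simp]: "space (\<mu> x) = UNIV" 
  by (simp add: vector_measure_def space_measure_of)

lemma sets_vm [simp, measurable_cong]: "sets (\<mu> x) = sets borel"
  using sets.sigma_sets_eq[of "borel :: real measure"] by (simp add: vector_measure_def)

text \<open>The set function in \<open>vector_measure\<close> becomes the value of the measure once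
  it is known to be countably additive; this follows from additivity of \<open>e\<close> by applying
  the continuous functional \<open>cinner _ x\<close>.\<close>

lemma emeasure_vm:
  assumes "B \<in> sets borel"
  shows "emeasure (\<mu> x) B = ennreal ((norm (e B x))\<^sup>2)"
proof -
  have 1: "Re (cinner (e B x) x) = (norm (e B x))\<^sup>2" if "B \<in> sets borel" for B
    using that by (simp add: cinner_e)
  have "emeasure (\<mu> x) B = ennreal (Re (cinner (e B x) x))"
  proof (rule emeasure_measure_of[OF vector_measure_def])
    show "positive (sets (\<mu> x)) (\<lambda>B. ennreal (Re (cinner (e B x) x)))"
      by (simp add: positive_def)
    show "countably_additive (sets (\<mu> x)) (\<lambda>B. ennreal (Re (cinner (e B x) x)))"
    proof (rule countably_additiveI)
      fix D :: "nat \<Rightarrow> real set"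
      assume D: "range D \<subseteq> sets (\<mu> x)" "disjoint_family D"
      have "(\<lambda>n. cinner (e (D n) x) x) sums cinner (e (\<Union>n. D n) x) x"
        using D by (intro bounded_linear.sums[OF bounded_linear_cinner_left] e_sums) auto
      then have "(\<lambda>n. Re (cinner (e (D n) x) x)) sums Re (cinner (e (\<Union>n. D n) x) x)"
        by (rule sums_Re)
      moreover have "0 \<le> Re (cinner (e (D n) x) x)" for n using D by (subst 1) auto
      ultimately show "(\<Sum>n. ennreal (Re (cinner (e (D n) x) x))) = ennreal (Re (cinner (e (\<Union>n. D n) x) x))"
        by (intro suminf_ennreal_eq)
    qed
  qed (use assms in auto)
  then show ?thesis using 1[OF assms] by simp
qed

text \<open>The integral may be computed on the level sets of any finite-valued \<open>u\<close>
  through which the function factors, rather than on its own level sets. Values in \<open>K\<close>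
  that \<open>u\<close> does not attain contribute \<open>e {}\<close>, which is zero.\<close>

lemma simple_integral_vector_comp:
  assumes "finite K" "range u \<subseteq> K" and m: "\<And>k. u -` {k} \<in> sets borel"
  shows "simple_integral_vector e (\<lambda>t. g (u t)) x = (\<Sum>k\<in>K. g k *\<^sub>C e (u -` {k}) x)"
proof -
  let ?R = "range u" and ?T = "range (\<lambda>t. g (u t))"
  have fin: "finite ?R" using assms finite_subset by blast
  have T: "?T = g ` ?R" by auto
  have "c *\<^sub>C e ((\<lambda>t. g (u t)) -` {c}) x = (\<Sum>k\<in>{k\<in>?R. g k = c}. g k *\<^sub>C e (u -` {k}) x)" for c
  proof -
    have "(\<lambda>t. g (u t)) -` {c} = (\<Union>k\<in>{k\<in>?R. g k = c}. u -` {k})" by auto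
    then have "e ((\<lambda>t. g (u t)) -` {c}) x = (\<Sum>k\<in>{k\<in>?R. g k = c}. e (u -` {k}) x)"
      using e_UN[of "{k\<in>?R. g k = c}" "\<lambda>k. u -` {k}" x] fin m by (auto simp: disjoint_family_on_def)
    then show ?thesis by (simp add: scaleC_sum_right)
  qed
  then have "simple_integral_vector e (\<lambda>t. g (u t)) x =
      (\<Sum>c\<in>?T. \<Sum>k\<in>{k\<in>?R. g k = c}. g k *\<^sub>C e (u -` {k}) x)"
    unfolding simple_integral_vector_def by (simp only:)
  also have "\<dots> = (\<Sum>k\<in>?R. g k *\<^sub>C e (u -` {k}) x)"
    by (rule sum.group) (use fin T in auto)
  also have "\<dots> = (\<Sum>k\<in>K. g k *\<^sub>C e (u -` {k}) x)"
  proof (rule sum.mono_neutral_left)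
    show "\<forall>k\<in>K - ?R. g k *\<^sub>C e (u -` {k}) x = 0"
    proof
      fix k assume "k \<in> K - ?R"
      then have "u -` {k} = {}" by auto
      then show "g k *\<^sub>C e (u -` {k}) x = 0" by simp
    qed
  qed (use assms in auto)
  finally show ?thesis .
qed

lemma simple_vimage: "simple_function borel s \<Longrightarrow> s -` {c} \<in> sets (borel :: real measure)"
  using simple_functionD(2)[of borel s "{c}"] by simp

lemma simple_finite: "simple_function (borel :: real measure) s \<Longrightarrow> finite (range s)"
  by (simp add: simple_function_def)

lemma simple_integral_vector_diff:
  assumes s: "simple_function borel s" and s': "simple_function borel s'"
  shows "simple_integral_vector e (\<lambda>t. s t - s' t) x = simple_integral_vector e s x - simple_integral_vector e s' x"
proof -
  \<comment> \<open>The level sets of the pair form a common refinement for \<open>s\<close>,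
    \<open>s'\<close> and their difference.\<close>
  define u where "u t = (s t, s' t)" for t
  have u: "simple_function borel u" unfolding u_def using assms by simp
  note c = simple_integral_vector_comp[OF simple_finite[OF u] order_refl simple_vimage[OF u]]
  show ?thesis
    using c[of "\<lambda>p. fst p - snd p" x] c[of fst x] c[of snd x]
    by (simp add: scaleC_diff_left sum_subtractf) (simp add: u_def)
qed

text \<open>The level sets are disjoint, so their projections of \<open>x\<close> are mutually
  orthogonal and Pythagoras matches the integral of the squared modulus term by term.\<close>

lemma simple_integral_isometry:
  assumes s: "simple_function borel s"
  shows "(\<integral>\<^sup>+ t. ennreal ((cmod (s t))\<^sup>2) \<partial>\<mu> x) = ennreal ((norm (simple_integral_vector e s x))\<^sup>2)"
proof -
  note fin = simple_finite[OF s] and m = simple_vimage[OF s]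
  note [measurable] = borel_measurable_simple_function[OF s]
  have "ennreal ((cmod (s t))\<^sup>2) = (\<Sum>c\<in>range s. ennreal ((cmod c)\<^sup>2) * indicator (s -` {c}) t)" for t
  proof -
    have "(\<Sum>c\<in>range s. ennreal ((cmod c)\<^sup>2) * indicator (s -` {c}) t) =
        (\<Sum>c\<in>{s t}. ennreal ((cmod c)\<^sup>2) * indicator (s -` {c}) t)"
      by (rule sum.mono_neutral_right) (auto simp: fin)
    then show ?thesis by simp
  qed
  then have "(\<integral>\<^sup>+ t. ennreal ((cmod (s t))\<^sup>2) \<partial>\<mu> x) =
      (\<integral>\<^sup>+ t. (\<Sum>c\<in>range s. ennreal ((cmod c)\<^sup>2) * indicator (s -` {c}) t) \<partial>\<mu> x)" by simp
  also have "\<dots> = (\<Sum>c\<in>range s. \<integral>\<^sup>+ t. ennreal ((cmod c)\<^sup>2) * indicator (s -` {c}) t \<partial>\<mu> x)"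
    using m by (intro nn_integral_sum) measurable
  also have "\<dots> = (\<Sum>c\<in>range s. ennreal ((cmod c)\<^sup>2) * ennreal ((norm (e (s -` {c}) x))\<^sup>2))"
    using m by (intro sum.cong refl) (simp add: nn_integral_cmult_indicator emeasure_vm)
  also have "\<dots> = ennreal (\<Sum>c\<in>range s. (norm (c *\<^sub>C e (s -` {c}) x))\<^sup>2)"
    by (simp add: norm_scaleC power_mult_distrib flip: ennreal_mult)
  also have "(\<Sum>c\<in>range s. (norm (c *\<^sub>C e (s -` {c}) x))\<^sup>2) = (norm (simple_integral_vector e s x))\<^sup>2"
    unfolding simple_integral_vector_def
  proof (rule norm_sum_Pythagorean[symmetric, OF fin])
    show "pairwise (\<lambda>i j. orthogonal (i *\<^sub>C e (s -` {i}) x) (j *\<^sub>C e (s -` {j}) x)) (range s)"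
    proof (rule pairwiseI)
      fix i j :: complex assume "i \<noteq> j"
      then have "e (s -` {i}) (e (s -` {j}) x) = 0" using m by (intro e_disjoint) auto
      then have "cinner (e (s -` {i}) x) (e (s -` {j}) x) = 0" using m by (simp add: e_selfadjoint)
      then show "orthogonal (i *\<^sub>C e (s -` {i}) x) (j *\<^sub>C e (s -` {j}) x)"
        unfolding orthogonal_def Re_cinner[symmetric] by (simp add: cinner_simps)
    qed
  qed
  finally show ?thesis .
qed

section \<open>Extension of the integral to square-integrable functions\<close>

lemma L2_triangle:
  assumes [measurable]: "a \<in> borel_measurable borel" "b \<in> borel_measurable borel" "f \<in> borel_measurable borel"
  shows "(\<integral>\<^sup>+ t. ennreal ((cmod (a t - b t))\<^sup>2) \<partial>\<mu> x) \<le>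
    2 * (\<integral>\<^sup>+ t. ennreal ((cmod (a t - f t))\<^sup>2) \<partial>\<mu> x) + 2 * (\<integral>\<^sup>+ t. ennreal ((cmod (b t - f t))\<^sup>2) \<partial>\<mu> x)"
proof -
  \<comment> \<open>The squared triangle inequality with factor 2 avoids square roots of extended
    nonnegative integrals.\<close>
  have "(cmod (p - q))\<^sup>2 \<le> 2 * (cmod (p - r))\<^sup>2 + 2 * (cmod (q - r))\<^sup>2" for p q r
  proof -
    have "cmod (p - q) \<le> cmod (p - r) + cmod (q - r)"
      using norm_triangle_ineq4[of "p - r" "q - r"] by simp
    then have "(cmod (p - q))\<^sup>2 \<le> (cmod (p - r) + cmod (q - r))\<^sup>2" by (simp add: power_mono)
    also have "\<dots> \<le> 2 * (cmod (p - r))\<^sup>2 + 2 * (cmod (q - r))\<^sup>2"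
      using zero_le_power2[of "cmod (p - r) - cmod (q - r)"] by (simp add: power2_eq_square algebra_simps)
    finally show ?thesis .
  qed
  then have "ennreal ((cmod (a t - b t))\<^sup>2) \<le> 2 * ennreal ((cmod (a t - f t))\<^sup>2) + 2 * ennreal ((cmod (b t - f t))\<^sup>2)" for t
    by (simp add: ennreal_mult flip: ennreal_numeral ennreal_mult ennreal_plus)
  then have "(\<integral>\<^sup>+ t. ennreal ((cmod (a t - b t))\<^sup>2) \<partial>\<mu> x) \<le>
    (\<integral>\<^sup>+ t. 2 * ennreal ((cmod (a t - f t))\<^sup>2) + 2 * ennreal ((cmod (b t - f t))\<^sup>2) \<partial>\<mu> x)"
    by (intro nn_integral_mono)
  also have "\<dots> = 2 * (\<integral>\<^sup>+ t. ennreal ((cmod (a t - f t))\<^sup>2) \<partial>\<mu> x) + 2 * (\<integral>\<^sup>+ t. ennreal ((cmod (b t - f t))\<^sup>2) \<partial>\<mu> x)"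
    by (subst nn_integral_add) (auto simp: nn_integral_cmult)
  finally show ?thesis .
qed

text \<open>This is the premise on \<open>s\<close> in the definite description of
  \<open>spectral_integral\<close>, named so that it can be passed between lemmas.\<close>

definition L2_approx :: "'h \<Rightarrow> (real \<Rightarrow> complex) \<Rightarrow> (nat \<Rightarrow> real \<Rightarrow> complex) \<Rightarrow> bool" where
  "L2_approx x f s \<longleftrightarrow> (\<forall>n. simple_function borel (s n)) \<and>
     (\<lambda>n. \<integral>\<^sup>+ t. ennreal ((cmod (s n t - f t))\<^sup>2) \<partial>\<mu> x) \<longlonglongrightarrow> 0"

lemma simple_integral_dist:
  assumes s: "simple_function borel a" "simple_function borel b" and f: "f \<in> borel_measurable borel"
  shows "ennreal ((norm (simple_integral_vector e a x - simple_integral_vector e b x))\<^sup>2) \<le>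
    2 * (\<integral>\<^sup>+ t. ennreal ((cmod (a t - f t))\<^sup>2) \<partial>\<mu> x) + 2 * (\<integral>\<^sup>+ t. ennreal ((cmod (b t - f t))\<^sup>2) \<partial>\<mu> x)"
  using L2_triangle[of a b f x] s f simple_integral_isometry[of "\<lambda>t. a t - b t" x]
  by (simp add: simple_integral_vector_diff borel_measurable_simple_function)

lemma L2_approx_exists:
  assumes [measurable]: "f \<in> borel_measurable borel"
    and fin: "(\<integral>\<^sup>+ t. ennreal ((cmod (f t))\<^sup>2) \<partial>\<mu> x) < \<infinity>"
  obtains s where "L2_approx x f s"
proof -
  obtain s where s: "\<And>i. simple_function borel (s i)" "\<And>t. (\<lambda>i. s i t) \<longlonglongrightarrow> f t"
      "\<And>i t. dist (s i t) 0 \<le> 2 * dist (f t) 0"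
    using borel_measurable_implies_sequence_metric[OF assms(1), of 0] by auto
  note [measurable] = borel_measurable_simple_function[OF s(1)]
  have "(\<lambda>n. \<integral>\<^sup>+ t. ennreal ((cmod (s n t - f t))\<^sup>2) \<partial>\<mu> x) \<longlonglongrightarrow> (\<integral>\<^sup>+ t. 0 \<partial>\<mu> x)"
  \<comment> \<open>The approximants satisfy \<open>cmod (s n t) \<le> 2 * cmod (f t)\<close>, so
    the difference from \<open>f\<close> is at most three times \<open>f\<close> in modulus, which
    explains the factor 9.\<close>
  proof (rule nn_integral_dominated_convergence[where w = "\<lambda>t. 9 * ennreal ((cmod (f t))\<^sup>2)"])
    show "AE t in \<mu> x. ennreal ((cmod (s n t - f t))\<^sup>2) \<le> 9 * ennreal ((cmod (f t))\<^sup>2)" for n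
    proof (rule AE_I2)
      fix t
      have "cmod (s n t - f t) \<le> 3 * cmod (f t)" 
        using s(3)[of n t] norm_triangle_ineq4[of "s n t" "f t"] by simp
      then have "(cmod (s n t - f t))\<^sup>2 \<le> (3 * cmod (f t))\<^sup>2" by (rule power_mono) simp
      then show "ennreal ((cmod (s n t - f t))\<^sup>2) \<le> 9 * ennreal ((cmod (f t))\<^sup>2)"
        by (simp add: power_mult_distrib flip: ennreal_numeral ennreal_mult)
    qed
    show "(\<integral>\<^sup>+ t. 9 * ennreal ((cmod (f t))\<^sup>2) \<partial>\<mu> x) < \<infinity>"
      using fin by (subst nn_integral_cmult) (auto simp: ennreal_mult_less_top)
    show "AE t in \<mu> x. (\<lambda>n. ennreal ((cmod (s n t - f t))\<^sup>2)) \<longlonglongrightarrow> 0"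
    proof (rule AE_I2)
      fix t
      have "(\<lambda>n. (cmod (s n t - f t))\<^sup>2) \<longlonglongrightarrow> (cmod (f t - f t))\<^sup>2"
        by (intro tendsto_intros s)
      then show "(\<lambda>n. ennreal ((cmod (s n t - f t))\<^sup>2)) \<longlonglongrightarrow> 0"
        using tendsto_ennrealI by fastforce
    qed
  qed measurable
  then show ?thesis using s(1) that by (auto simp: L2_approx_def)
qed

text \<open>By the isometry, an approximating sequence of simple functions has a Cauchy sequence of
  integrals, and any two such sequences have the same limit. Since an approximating sequence exists,
  the definite description is well defined, and its value can afterwards be computed along any such
  sequence.\<close>

lemma spectral_integral_exists:
  assumes f: "f \<in> borel_measurable borel"
    and fin: "(\<integral>\<^sup>+ t. ennreal ((cmod (f t))\<^sup>2) \<partial>\<mu> x) < \<infinity>"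
  obtains y where "spectral_integral e f x = Some y"
    and "\<And>s. L2_approx x f s \<Longrightarrow> (\<lambda>n. simple_integral_vector e (s n) x) \<longlonglongrightarrow> y"
proof -
  let ?I = "\<lambda>s. simple_integral_vector e s x"
  let ?d = "\<lambda>s. \<integral>\<^sup>+ t. ennreal ((cmod (s t - f t))\<^sup>2) \<partial>\<mu> x"
  obtain s where s: "L2_approx x f s" using L2_approx_exists[OF assms] .
  \<comment> \<open>The bound \<epsilon> squared over 8, taken for two functions and doubled by
    \<open>simple_integral_dist\<close>, adds up to half of \<epsilon> squared.\<close>
  have close: "\<exists>N. \<forall>n\<ge>N. ?d (a n) < ennreal (\<epsilon>\<^sup>2 / 8)" if "L2_approx x f a" "\<epsilon> > 0" for a and \<epsilon> :: real
  proof -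
    have "(\<lambda>n. ?d (a n)) \<longlonglongrightarrow> 0" using that(1) by (simp add: L2_approx_def)
    then have "eventually (\<lambda>n. ?d (a n) < ennreal (\<epsilon>\<^sup>2 / 8)) sequentially"
      by (rule order_tendstoD) (use that in simp)
    then show ?thesis by (simp add: eventually_sequentially)
  qed
  have dist: "norm (?I a - ?I b) < \<epsilon>"
    if "simple_function borel a" "simple_function borel b"
       "?d a < ennreal (\<epsilon>\<^sup>2 / 8)" "?d b < ennreal (\<epsilon>\<^sup>2 / 8)" "\<epsilon> > 0" for a b and \<epsilon> :: real
  proof -
    have "ennreal ((norm (?I a - ?I b))\<^sup>2) \<le> 2 * ?d a + 2 * ?d b"
      by (rule simple_integral_dist) (use that f in auto)
    also have "\<dots> \<le> 2 * ennreal (\<epsilon>\<^sup>2 / 8) + 2 * ennreal (\<epsilon>\<^sup>2 / 8)"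
      using that by (intro add_mono mult_left_mono) auto
    also have "\<dots> = ennreal (\<epsilon>\<^sup>2 / 2)"
      by (simp flip: ennreal_numeral ennreal_mult ennreal_plus)
    finally have "(norm (?I a - ?I b))\<^sup>2 \<le> \<epsilon>\<^sup>2 / 2" by simp
    also have "\<dots> < \<epsilon>\<^sup>2" using that by simp
    finally have "(norm (?I a - ?I b))\<^sup>2 < \<epsilon>\<^sup>2" .
    then show ?thesis using that by (simp add: power_less_imp_less_base)
  qed
  have simp: "simple_function borel (a n)" if "L2_approx x f a" for a n
    using that by (simp add: L2_approx_def)
  have "Cauchy (\<lambda>n. ?I (s n))"
  proof (rule metric_CauchyI)
    fix \<epsilon> :: real assume "\<epsilon> > 0"
    with close[OF s] obtain N where "\<And>n. n \<ge> N \<Longrightarrow> ?d (s n) < ennreal (\<epsilon>\<^sup>2 / 8)" by blast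
    then show "\<exists>M. \<forall>m\<ge>M. \<forall>n\<ge>M. dist (?I (s m)) (?I (s n)) < \<epsilon>"
      using dist simp[OF s] \<open>\<epsilon> > 0\<close> unfolding dist_norm by blast
  qed
  then obtain y where y: "(\<lambda>n. ?I (s n)) \<longlonglongrightarrow> y" by (auto simp: Cauchy_convergent_iff convergent_def)
  have lim: "(\<lambda>n. ?I (a n)) \<longlonglongrightarrow> y" if a: "L2_approx x f a" for a
  proof -
    have "(\<lambda>n. ?I (a n) - ?I (s n)) \<longlonglongrightarrow> 0"
    proof (rule LIMSEQ_I)
      fix \<epsilon> :: real assume "\<epsilon> > 0"
      with close[OF s] close[OF a] obtain N M where 
        "\<And>n. n \<ge> N \<Longrightarrow> ?d (s n) < ennreal (\<epsilon>\<^sup>2 / 8)" "\<And>n. n \<ge> M \<Longrightarrow> ?d (a n) < ennreal (\<epsilon>\<^sup>2 / 8)" by meson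
      then have "\<forall>n\<ge>max N M. norm (?I (a n) - ?I (s n) - 0) < \<epsilon>"
        using dist[OF simp[OF a] simp[OF s]] \<open>\<epsilon> > 0\<close> by simp
      then show "\<exists>no. \<forall>n\<ge>no. norm (?I (a n) - ?I (s n) - 0) < \<epsilon>" by blast
    qed
    then have "(\<lambda>n. ?I (a n) - ?I (s n) + ?I (s n)) \<longlonglongrightarrow> 0 + y" using y by (rule tendsto_add)
    then show ?thesis by simp
  qed
  have "(THE y. \<forall>s. (\<forall>n. simple_function borel (s n)) \<and> (\<lambda>n. ?d (s n)) \<longlonglongrightarrow> 0 
      \<longrightarrow> (\<lambda>n. ?I (s n)) \<longlonglongrightarrow> y) = y"
  proof (rule the_equality)
    show "\<forall>s. (\<forall>n. simple_function borel (s n)) \<and> (\<lambda>n. ?d (s n)) \<longlonglongrightarrow> 0 \<longrightarrow> (\<lambda>n. ?I (s n)) \<longlonglongrightarrow> y"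
      using lim by (simp add: L2_approx_def)
  next
    fix z assume "\<forall>s. (\<forall>n. simple_function borel (s n)) \<and> (\<lambda>n. ?d (s n)) \<longlonglongrightarrow> 0 \<longrightarrow> (\<lambda>n. ?I (s n)) \<longlonglongrightarrow> z"
    then have "(\<lambda>n. ?I (s n)) \<longlonglongrightarrow> z" using s by (simp add: L2_approx_def)
    then show "z = y" using y LIMSEQ_unique by blast
  qed
  then have "spectral_integral e f x = Some y" unfolding spectral_integral_def using fin by simp
  then show ?thesis using lim that by blast
qed

lemma spectral_integral_domain:
  "spectral_integral e f x = Some y \<Longrightarrow> (\<integral>\<^sup>+ t. ennreal ((cmod (f t))\<^sup>2) \<partial>\<mu> x) < \<infinity>"
  by (auto simp: spectral_integral_def split: if_splits)

text \<open>The constant sequence with value \<open>s\<close> is an admissible approximation,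
  because its distance to \<open>f\<close> in L2 is zero.\<close>

lemma spectral_integral_AE_simple:
  assumes f: "f \<in> borel_measurable borel" and s: "simple_function borel s"
    and eq: "AE t in \<mu> x. f t = s t"
  shows "spectral_integral e f x = Some (simple_integral_vector e s x)"
proof -
  have "(\<integral>\<^sup>+ t. ennreal ((cmod (f t))\<^sup>2) \<partial>\<mu> x) = (\<integral>\<^sup>+ t. ennreal ((cmod (s t))\<^sup>2) \<partial>\<mu> x)"
    using eq by (intro nn_integral_cong_AE) auto
  then have "(\<integral>\<^sup>+ t. ennreal ((cmod (f t))\<^sup>2) \<partial>\<mu> x) < \<infinity>" 
    by (simp add: simple_integral_isometry[OF s])
  then obtain y where y: "spectral_integral e f x = Some y"
    "\<And>s. L2_approx x f s \<Longrightarrow> (\<lambda>n. simple_integral_vector e (s n) x) \<longlonglongrightarrow> y"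
    using spectral_integral_exists[OF f] by blast
  have "(\<integral>\<^sup>+ t. ennreal ((cmod (s t - f t))\<^sup>2) \<partial>\<mu> x) = (\<integral>\<^sup>+ t. 0 \<partial>\<mu> x)"
    using eq by (intro nn_integral_cong_AE) auto
  then have "L2_approx x f (\<lambda>_. s)" using s by (simp add: L2_approx_def)
  then have "(\<lambda>n. simple_integral_vector e s x) \<longlonglongrightarrow> y" by (rule y(2))
  then have "y = simple_integral_vector e s x" using LIMSEQ_unique tendsto_const by blast
  then show ?thesis using y(1) by simp
qed

section \<open>Indicators, atoms and commutation with the spectral measure\<close>

lemma simple_indicator:
  "C \<in> sets borel \<Longrightarrow> simple_function (borel :: real measure) (\<lambda>t. if t \<in> C then c else 0)"
  by (rule simple_function_If) auto

text \<open>Factoring through the truth value of \<open>t \<in> C\<close> avoids case distinctions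
  on whether \<open>c\<close> is zero or \<open>C\<close> is trivial.\<close>

lemma simple_integral_indicator:
  assumes C: "C \<in> sets borel"
  shows "simple_integral_vector e (\<lambda>t. if t \<in> C then c else 0) x = c *\<^sub>C e C x"
proof -
  have v: "(\<lambda>t. t \<in> C) -` {k} = (if k then C else - C)" for k by auto
  have "simple_integral_vector e (\<lambda>t. if t \<in> C then c else 0) x =
      (\<Sum>k\<in>{False, True}. (if k then c else 0) *\<^sub>C e ((\<lambda>t. t \<in> C) -` {k}) x)"
    by (rule simple_integral_vector_comp[where g = "\<lambda>b. if b then c else 0"])
       (use C in \<open>auto simp: v\<close>)
  then show ?thesis by (simp add: v)
qed

lemma spectral_integral_indicator:
  assumes "C \<in> sets borel"
  shows "spectral_integral e (\<lambda>t. if t \<in> C then c else 0) x = Some (c *\<^sub>C e C x)"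
  using spectral_integral_AE_simple[OF borel_measurable_simple_function[OF simple_indicator[OF assms]] simple_indicator[OF assms]]
  by (simp add: simple_integral_indicator[OF assms])

text \<open>The scalar measure of \<open>x\<close> is concentrated on \<open>{t}\<close>, so
  \<open>f\<close> agrees almost everywhere with a multiple of the indicator of that point.\<close>

lemma spectral_integral_atom:
  assumes f: "f \<in> borel_measurable borel" and x: "e {t} x = x"
  shows "spectral_integral e f x = Some (f t *\<^sub>C x)"
proof -
  have "e (- {t}) x = e (- {t}) (e {t} x)" by (simp add: x)
  also have "\<dots> = 0" by (rule e_disjoint) auto
  finally have "emeasure (\<mu> x) (- {t}) = 0" by (subst emeasure_vm) auto
  then have "AE r in \<mu> x. r = t" by (intro AE_I[of _ _ "- {t}"]) auto
  then have "AE r in \<mu> x. f r = (if r \<in> {t} then f t else 0)" by eventually_elim simp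
  then show ?thesis
    using spectral_integral_AE_simple[OF f simple_indicator[of "{t}" "f t"]] 
    by (simp add: simple_integral_indicator[of "{t}", simplified] x)
qed

text \<open>Since \<open>e C\<close> is a contraction commuting with every \<open>e B\<close>, the
  scalar measure of \<open>e C x\<close> is dominated by that of \<open>x\<close>. One sequence of
  simple functions therefore approximates \<open>f\<close> for both vectors; commutation is
  immediate on simple functions and passes to the limit.\<close>

lemma spectral_integral_commute:
  assumes f: "f \<in> borel_measurable borel" and C: "C \<in> sets borel"
    and x: "spectral_integral e f x = Some y"
  shows "spectral_integral e f (e C x) = Some (e C y)"
proof -
  note fin = spectral_integral_domain[OF x]
  have le: "(\<integral>\<^sup>+ t. ennreal (g t) \<partial>\<mu> (e C x)) \<le> (\<integral>\<^sup>+ t. ennreal (g t) \<partial>\<mu> x)" for g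
  proof (rule nn_integral_mono_measure)
    show "sets (\<mu> (e C x)) = sets (\<mu> x)" by simp
    show "\<mu> (e C x) \<le> \<mu> x"
    proof (intro le_measure[THEN iffD2] ballI)
      fix B assume "B \<in> sets (\<mu> (e C x))"
      then have B: "B \<in> sets borel" by simp
      have "norm (e B (e C x)) \<le> norm (e B x)"
      proof -
        have "e B (e C x) = e C (e B x)" using B C by (simp add: e_Int Int_commute)
        moreover have "(norm (e C z))\<^sup>2 \<le> norm (e C z) * norm z" for z
          using norm_cinner_le[of "e C z" z] C by (simp add: cinner_e norm_power)
        then have "norm (e C z) \<le> norm z" for z
          by (metis mult_left_le_imp_le norm_ge_zero norm_le_zero_iff not_le power2_eq_square order_le_less)
        ultimately show ?thesis by simp
      qed
      then show "emeasure (\<mu> (e C x)) B \<le> emeasure (\<mu> x) B" 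
        using B by (simp add: emeasure_vm power_mono ennreal_leI)
    qed simp
  qed
  have fin': "(\<integral>\<^sup>+ t. ennreal ((cmod (f t))\<^sup>2) \<partial>\<mu> (e C x)) < \<infinity>"
    using le fin by (rule order.strict_trans1)
  obtain s where s: "L2_approx x f s" using L2_approx_exists[OF f fin] .
  have "(\<lambda>n. \<integral>\<^sup>+ t. ennreal ((cmod (s n t - f t))\<^sup>2) \<partial>\<mu> (e C x)) \<longlonglongrightarrow> 0"
    by (rule tendsto_sandwich[OF _ _ tendsto_const]) (use s le in \<open>auto simp: L2_approx_def\<close>)
  then have s': "L2_approx (e C x) f s" using s by (simp add: L2_approx_def)
  have "simple_integral_vector e (s n) (e C x) = e C (simple_integral_vector e (s n) x)" for n
  proof -
    have "simple_function borel (s n)" using s by (simp add: L2_approx_def)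
    note m = simple_vimage[OF this]
    show ?thesis
      unfolding simple_integral_vector_def linear_sum[OF e_linear[OF C]]
      by (intro sum.cong refl) 
        (simp add: bounded_operatorsD(2)[OF e_bounded_operator[OF C]] e_Int C m Int_commute)
  qed
  moreover have "(\<lambda>n. simple_integral_vector e (s n) x) \<longlonglongrightarrow> y"
    using spectral_integral_exists[OF f fin] x s by (metis option.inject)
  then have "(\<lambda>n. e C (simple_integral_vector e (s n) x)) \<longlonglongrightarrow> e C y"
    by (rule bounded_linear.tendsto[OF e_bounded_linear[OF C]])
  moreover obtain z where z: "spectral_integral e f (e C x) = Some z"
    "(\<lambda>n. simple_integral_vector e (s n) (e C x)) \<longlonglongrightarrow> z"
    using spectral_integral_exists[OF f fin'] s' by metis
  ultimately have "z = e C y" using LIMSEQ_unique by fastforce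
  with z show ?thesis by simp
qed

text \<open>A probability measure on the line with values 0 and 1 only is a point mass. Outside one
  null set, all points lie below exactly the same rationals, and by density of the rationals such
  points coincide.\<close>

lemma zero_one_atom:
  assumes zo: "\<And>C. C \<in> sets borel \<Longrightarrow> norm (e C x) = 0 \<or> norm (e C x) = 1" and x: "norm x = 1"
  obtains t where "e {t} x = x"
proof -
  have one: "norm (e C x) = 1 \<longleftrightarrow> (AE t in \<mu> x. t \<in> C)" 
    and zero: "norm (e C x) = 0 \<longleftrightarrow> (AE t in \<mu> x. t \<notin> C)" if C: "C \<in> sets borel" for C
  proof -
    have z: "norm (e C x) = 0 \<longleftrightarrow> (AE t in \<mu> x. t \<notin> C)" if C: "C \<in> sets borel" for C
    proof -
      have "norm (e C x) = 0 \<longleftrightarrow> emeasure (\<mu> x) {t \<in> space (\<mu> x). \<not> t \<notin> C} = 0"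
        using C by (simp add: emeasure_vm)
      also have "\<dots> \<longleftrightarrow> (AE t in \<mu> x. t \<notin> C)"
        using C by (intro AE_iff_measurable[symmetric, OF _ refl]) simp
      finally show ?thesis .
    qed
    show "norm (e C x) = 0 \<longleftrightarrow> (AE t in \<mu> x. t \<notin> C)" by (rule z[OF C])
    have "x = e C x + e (- C) x" using e_Un[of C "- C" x] C by simp
    moreover have "inner (e C x) (e (- C) x) = 0"
    proof -
      have "cinner (e C x) (e (- C) x) = cinner x (e C (e (- C) x))" using C by (simp add: e_selfadjoint)
      also have "e C (e (- C) x) = 0" using C by (intro e_disjoint) auto
      finally show ?thesis by (simp flip: Re_cinner)
    qed
    ultimately have "(norm x)\<^sup>2 = (norm (e C x))\<^sup>2 + (norm (e (- C) x))\<^sup>2"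
      by (metis norm_add_Pythagorean orthogonal_def)
    then have "norm (e C x) = 1 \<longleftrightarrow> norm (e (- C) x) = 0" 
      using x zo[OF C] by auto
    then show "norm (e C x) = 1 \<longleftrightarrow> (AE t in \<mu> x. t \<in> C)" using z[of "- C"] C by simp
  qed
  \<comment> \<open>\<open>P r\<close> says that the half-line up to \<open>r\<close> has full
    measure; otherwise it is a null set. Restricting to rational \<open>r\<close> leaves countably
    many almost-everywhere statements to combine.\<close>
  define P where "P r \<longleftrightarrow> norm (e {..r} x) = 1" for r
  have "AE t in \<mu> x. t \<le> r \<longleftrightarrow> P r" for r
    using one[of "{..r}"] zero[of "{..r}"] zo[of "{..r}"] by (cases "P r") (auto simp: P_def)
  then have ae: "AE t in \<mu> x. \<forall>q::rat. t \<le> of_rat q \<longleftrightarrow> P (of_rat q)"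
    by (simp add: AE_all_countable)
  \<comment> \<open>A set of full measure is nonempty: otherwise \<open>e {} x\<close> would have
    norm 1.\<close>
  obtain t :: real where t: "\<forall>q::rat. t \<le> of_rat q \<longleftrightarrow> P (of_rat q)"
  proof (rule ccontr)
    assume "\<not> thesis"
    then have "AE t in \<mu> x. False" using ae that by (auto elim!: eventually_mono)
    then have "AE t in \<mu> x. t \<in> {}" by simp
    then have "norm (e {} x) = 1" by (subst one) auto
    then show False by simp
  qed
  have "AE r in \<mu> x. r \<notin> - {t}"
    using ae
  proof eventually_elim
    fix r :: real assume r: "\<forall>q::rat. r \<le> of_rat q \<longleftrightarrow> P (of_rat q)"
    have "\<not> r < t" "\<not> t < r"
      using r t of_rat_dense[of r t] of_rat_dense[of t r] by (metis less_imp_le not_le)+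
    then show "r \<notin> - {t}" by simp
  qed
  then have "e (- {t}) x = 0" using zero[of "- {t}"] by auto
  then have "e {t} x = x" using e_Un[of "{t}" "- {t}" x] by simp
  then show ?thesis by (rule that)
qed

end

subsection \<open>Positive maps reproducing a vector state\<close>

text \<open>For a unit vector \<psi> this is the orthogonal projection onto its span; in general it
  is that projection scaled by the squared norm of \<psi>.\<close>

definition vector_projection :: "'h::complex_hilbert \<Rightarrow> 'h \<Rightarrow> 'h" where
  "vector_projection \<psi> y = cinner y \<psi> *\<^sub>C \<psi>"

lemma vector_projection_bounded: "vector_projection \<psi> \<in> bounded_operators"
  unfolding bounded_operators_def vector_projection_def
  by (auto simp: cinner_simps scaleC_scaleC
      intro: bounded_linear_compose[OF bounded_linear_scaleC_left bounded_linear_cinner_left])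

lemma cinner_vector_projection:
  "cinner (vector_projection \<psi> y) y = of_real ((cmod (cinner y \<psi>))\<^sup>2)"
  by (metis cinner_commute cinner_scaleC_left complex_norm_square vector_projection_def)

lemma positive_operatorD:
  assumes "positive_operator A"
  shows "Im (cinner (A x) x) = 0" "0 \<le> Re (cinner (A x) x)"
  using assms by (auto simp: positive_operator_def complex_is_Real_iff)

lemma linear_mapD:
  assumes "linear_map \<alpha>" "A \<in> bounded_operators" "B \<in> bounded_operators"
  shows "\<alpha> (\<lambda>x. a *\<^sub>C A x + b *\<^sub>C B x) = (\<lambda>x. a *\<^sub>C \<alpha> A x + b *\<^sub>C \<alpha> B x)"
  using assms by (auto simp: linear_map_def)

definition compl_projection :: "'h::complex_hilbert \<Rightarrow> 'h \<Rightarrow> 'h" where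
  "compl_projection \<psi> y = y - vector_projection \<psi> y"

text \<open>The redundant scalars match the shape of combination to which \<^const>\<open>linear_map\<close> applies.\<close>

lemma compl_projection_lincomb:
  "compl_projection \<psi> = (\<lambda>y. 1 *\<^sub>C y + (-1) *\<^sub>C vector_projection \<psi> y)"
  by (auto simp: compl_projection_def)

lemma compl_projection_bounded: "compl_projection \<psi> \<in> bounded_operators"
  unfolding compl_projection_lincomb
  by (rule bounded_operators_lincomb[OF bounded_operators_id vector_projection_bounded])

lemma cinner_compl_projection:
  assumes "norm \<psi> = 1"
  shows "cinner (compl_projection \<psi> y) y = of_real ((norm (compl_projection \<psi> y))\<^sup>2)"
proof -
  have "cinner (compl_projection \<psi> y) (vector_projection \<psi> y) = 0"
    by (simp add: compl_projection_def vector_projection_def cinner_simps cinner_self assms)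
  then have "cinner (compl_projection \<psi> y) y = cinner (compl_projection \<psi> y) (compl_projection \<psi> y)"
    unfolding compl_projection_def[of \<psi> y] by (simp add: cinner_diff_right)
  then show ?thesis by (simp only: cinner_self)
qed

text \<open>The cross terms between \<open>\<psi>\<close> and its complement cost only \<open>\<epsilon>\<close> on \<open>\<psi>\<close>, at the price of a large
  multiple \<open>K\<close> of the complementary projection; a functional annihilating that projection does
  not see \<open>K\<close>.\<close>

lemma hermitian_form_le:
  assumes h: "h \<in> bounded_operators" and \<psi>: "norm \<psi> = 1" and \<epsilon>: "\<epsilon> > 0"
  obtains K where "\<And>y. Re (cinner (h y) y) \<le>
     (Re (cinner (h \<psi>) \<psi>) + \<epsilon>) * (cmod (cinner y \<psi>))\<^sup>2 + K * (norm (compl_projection \<psi> y))\<^sup>2"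
proof -
  interpret h: bounded_linear h using bounded_operatorsD(1)[OF h] .
  obtain M where M: "M > 0" "\<And>x. norm (h x) \<le> norm x * M" using h.pos_bounded by blast
  have bound: "cmod (cinner (h x) y) \<le> norm x * M * norm y" for x y
    using norm_cinner_le[of "h x" y] M(2)[of x] by (meson mult_right_mono norm_ge_zero order_trans)
  have "Re (cinner (h y) y) \<le> (Re (cinner (h \<psi>) \<psi>) + \<epsilon>) * (cmod (cinner y \<psi>))\<^sup>2
      + (M\<^sup>2 / \<epsilon> + M) * (norm (compl_projection \<psi> y))\<^sup>2" for y
  proof -
    define a where "a = cinner y \<psi>"
    define v where "v = compl_projection \<psi> y"
    have y: "y = a *\<^sub>C \<psi> + v" by (simp add: v_def a_def compl_projection_def vector_projection_def)
    have "cinner (h y) y = a * cnj a * cinner (h \<psi>) \<psi> + a * cinner (h \<psi>) v + cnj a * cinner (h v) \<psi> + cinner (h v) v"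
      by (subst (1 2) y) (simp add: h.add bounded_operatorsD(2)[OF h] cinner_simps algebra_simps)
    also have "a * cnj a = of_real ((cmod a)\<^sup>2)" by (rule complex_norm_square[symmetric])
    finally have "Re (cinner (h y) y) = (cmod a)\<^sup>2 * Re (cinner (h \<psi>) \<psi>) + Re (a * cinner (h \<psi>) v)
        + Re (cnj a * cinner (h v) \<psi>) + Re (cinner (h v) v)" by simp
    moreover have "Re (a * cinner (h \<psi>) v) \<le> cmod a * (M * norm v)"
      using complex_Re_le_cmod[of "a * cinner (h \<psi>) v"] mult_left_mono[OF bound[of \<psi> v], of "cmod a"] \<psi>
      by (simp add: norm_mult)
    moreover have "Re (cnj a * cinner (h v) \<psi>) \<le> cmod a * (M * norm v)"
      using complex_Re_le_cmod[of "cnj a * cinner (h v) \<psi>"] mult_left_mono[OF bound[of v \<psi>], of "cmod a"] \<psi>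
      by (simp add: norm_mult mult_ac)
    moreover have "Re (cinner (h v) v) \<le> M * (norm v)\<^sup>2"
      using complex_Re_le_cmod[of "cinner (h v) v"] bound[of v v] by (simp add: power2_eq_square mult_ac)
    \<comment> \<open>Completing the square with weight \<epsilon> bounds both cross terms together
      and produces the summand \<open>M\<^sup>2 / \<epsilon>\<close> of the constant.\<close>
    moreover have "2 * (cmod a * (M * norm v)) \<le> \<epsilon> * (cmod a)\<^sup>2 + M\<^sup>2 / \<epsilon> * (norm v)\<^sup>2"
    proof -
      have "0 \<le> (\<epsilon> * cmod a - M * norm v)\<^sup>2 / \<epsilon>" using \<epsilon> by simp
      also have "\<dots> = \<epsilon> * (cmod a)\<^sup>2 + M\<^sup>2 / \<epsilon> * (norm v)\<^sup>2 - 2 * (cmod a * (M * norm v))"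
        using \<epsilon> by (simp add: power2_eq_square field_simps)
      finally show ?thesis by simp
    qed
    ultimately show ?thesis unfolding a_def[symmetric] v_def[symmetric] by (simp add: algebra_simps)
  qed
  then show ?thesis by (rule that)
qed

context
  fixes \<alpha> :: "('h::complex_hilbert \<Rightarrow> 'h) \<Rightarrow> ('h \<Rightarrow> 'h)" and \<psi> :: 'h
  assumes lin: "linear_map \<alpha>" and pos: "positive_map \<alpha>" and unit: "unital_map \<alpha>"
    and norm_\<psi>: "norm \<psi> = 1"
begin

lemma map_compl_projection: "\<alpha> (compl_projection \<psi>) \<xi> = \<xi> - \<alpha> (vector_projection \<psi>) \<xi>"
  unfolding compl_projection_lincomb linear_mapD[OF lin bounded_operators_id vector_projection_bounded]
  using unit by (simp add: unital_map_def)

lemma map_vector_projection_le: "Re (cinner (\<alpha> (vector_projection \<psi>) \<xi>) \<xi>) \<le> (norm \<xi>)\<^sup>2"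
proof -
  have "positive_operator (compl_projection \<psi>)"
    by (simp add: positive_operator_def complex_is_Real_iff compl_projection_bounded
        cinner_compl_projection[OF norm_\<psi>])
  then have "positive_operator (\<alpha> (compl_projection \<psi>))" using pos by (simp add: positive_map_def)
  from positive_operatorD(2)[OF this, of \<xi>] show ?thesis
    by (simp add: map_compl_projection cinner_diff_left cinner_self)
qed

text \<open>For large \<open>K\<close> the operator \<open>r P + K Q - h\<close> is positive, where
  \<open>P\<close> and \<open>Q\<close> are the projection onto \<psi> and its complement and
  \<open>r\<close> exceeds the form of \<open>h\<close> at \<psi> by \<epsilon>. Apply \<alpha> and
  evaluate at \<xi>: the hypothesis on \<xi> removes the \<open>Q\<close> term whatever
  \<open>K\<close> is, and \<epsilon> tends to 0.\<close>

lemma positive_map_form_le: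
  assumes h: "h \<in> bounded_operators" and real: "\<And>x. Im (cinner (h x) x) = 0"
    and \<xi>: "cinner (\<alpha> (vector_projection \<psi>) \<xi>) \<xi> = of_real ((norm \<xi>)\<^sup>2)"
  shows "Im (cinner (\<alpha> h \<xi>) \<xi>) = 0"
    and "Re (cinner (\<alpha> h \<xi>) \<xi>) \<le> Re (cinner (h \<psi>) \<psi>) * (norm \<xi>)\<^sup>2"
proof -
  let ?P = "vector_projection \<psi>" and ?Q = "compl_projection \<psi>"
  have Q0: "cinner (\<alpha> ?Q \<xi>) \<xi> = 0"
    by (simp add: map_compl_projection cinner_diff_left cinner_self \<xi>)
  have *: "Im (cinner (\<alpha> h \<xi>) \<xi>) = 0 \<and>
      Re (cinner (\<alpha> h \<xi>) \<xi>) \<le> (Re (cinner (h \<psi>) \<psi>) + \<epsilon>) * (norm \<xi>)\<^sup>2" if "\<epsilon> > 0" for \<epsilon>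
  proof -
    obtain K where K: "\<And>y. Re (cinner (h y) y) \<le>
     (Re (cinner (h \<psi>) \<psi>) + \<epsilon>) * (cmod (cinner y \<psi>))\<^sup>2 + K * (norm (?Q y))\<^sup>2"
      using hermitian_form_le[OF h norm_\<psi> \<open>\<epsilon> > 0\<close>] by blast
    define r where "r = Re (cinner (h \<psi>) \<psi>) + \<epsilon>"
    define B where "B = (\<lambda>x. of_real r *\<^sub>C ?P x + of_real K *\<^sub>C ?Q x)"
    define D where "D = (\<lambda>x. 1 *\<^sub>C B x + (-1) *\<^sub>C h x)"
    have B: "B \<in> bounded_operators"
      unfolding B_def by (rule bounded_operators_lincomb[OF vector_projection_bounded compl_projection_bounded])
    have D: "D \<in> bounded_operators"
      unfolding D_def by (rule bounded_operators_lincomb[OF B h])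
    have "cinner (D y) y = of_real (r * (cmod (cinner y \<psi>))\<^sup>2 + K * (norm (?Q y))\<^sup>2) - cinner (h y) y" for y
    proof -
      have "cinner (D y) y = of_real r * cinner (?P y) y + of_real K * cinner (?Q y) y - cinner (h y) y"
        by (simp only: D_def B_def cinner_simps) simp
      then show ?thesis by (simp only: cinner_vector_projection cinner_compl_projection[OF norm_\<psi>]) simp
    qed
    then have "positive_operator D"
      unfolding positive_operator_def complex_is_Real_iff using D K real by (simp add: r_def)
    then have "positive_operator (\<alpha> D)" using pos by (simp add: positive_map_def)
    moreover have "cinner (\<alpha> D \<xi>) \<xi> = of_real (r * (norm \<xi>)\<^sup>2) - cinner (\<alpha> h \<xi>) \<xi>"
    proof -
      have "\<alpha> D = (\<lambda>x. 1 *\<^sub>C \<alpha> B x + (-1) *\<^sub>C \<alpha> h x)" 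
        unfolding D_def by (rule linear_mapD[OF lin B h])
      moreover have "\<alpha> B = (\<lambda>x. of_real r *\<^sub>C \<alpha> ?P x + of_real K *\<^sub>C \<alpha> ?Q x)"
        unfolding B_def by (rule linear_mapD[OF lin vector_projection_bounded compl_projection_bounded])
      ultimately have "cinner (\<alpha> D \<xi>) \<xi> = of_real r * cinner (\<alpha> ?P \<xi>) \<xi> + of_real K * cinner (\<alpha> ?Q \<xi>) \<xi> - cinner (\<alpha> h \<xi>) \<xi>"
        by (simp only: cinner_simps) simp
      then show ?thesis by (simp only: Q0 \<xi>) simp
    qed
    ultimately show ?thesis
      using positive_operatorD[of "\<alpha> D" \<xi>] by (simp add: r_def)
  qed
  then show "Im (cinner (\<alpha> h \<xi>) \<xi>) = 0" using zero_less_one by blast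
  show "Re (cinner (\<alpha> h \<xi>) \<xi>) \<le> Re (cinner (h \<psi>) \<psi>) * (norm \<xi>)\<^sup>2"
  proof (rule tendsto_lowerbound)
    show "((\<lambda>\<epsilon>. (Re (cinner (h \<psi>) \<psi>) + \<epsilon>) * (norm \<xi>)\<^sup>2) \<longlongrightarrow> Re (cinner (h \<psi>) \<psi>) * (norm \<xi>)\<^sup>2) (at_right 0)"
      by (auto intro!: tendsto_eq_intros)
    show "\<forall>\<^sub>F \<epsilon> in at_right 0. Re (cinner (\<alpha> h \<xi>) \<xi>) \<le> (Re (cinner (h \<psi>) \<psi>) + \<epsilon>) * (norm \<xi>)\<^sup>2"
      using * by (intro eventually_at_rightI[of 0 1]) auto
  qed simp
qed

text \<open>The upper bound applied to the negative of \<open>h\<close> is the matching lower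
  bound.\<close>

lemma positive_map_form_hermitian:
  assumes h: "h \<in> bounded_operators" and real: "\<And>x. Im (cinner (h x) x) = 0"
    and \<xi>: "cinner (\<alpha> (vector_projection \<psi>) \<xi>) \<xi> = of_real ((norm \<xi>)\<^sup>2)"
  shows "cinner (\<alpha> h \<xi>) \<xi> = cinner (h \<psi>) \<psi> * of_real ((norm \<xi>)\<^sup>2)"
proof -
  \<comment> \<open>The summand with coefficient 0 only completes the linear combination to the
    shape covered by \<open>linear_map\<close>.\<close>
  let ?m = "\<lambda>x. (-1) *\<^sub>C h x + 0 *\<^sub>C h x"
  have "?m \<in> bounded_operators" by (rule bounded_operators_lincomb[OF h h])
  moreover have "Im (cinner (?m x) x) = 0" for x using real by (simp add: cinner_minus_left)
  ultimately have "Re (cinner (\<alpha> ?m \<xi>) \<xi>) \<le> Re (cinner (?m \<psi>) \<psi>) * (norm \<xi>)\<^sup>2"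
    using \<xi> by (rule positive_map_form_le(2))
  moreover have "cinner (\<alpha> ?m \<xi>) \<xi> = - cinner (\<alpha> h \<xi>) \<xi>"
    unfolding linear_mapD[OF lin h h] by (simp add: cinner_minus_left)
  ultimately show ?thesis
    using positive_map_form_le[OF h real \<xi>] real
    by (simp add: complex_eq_iff cinner_minus_left)
qed

text \<open>Cartesian decomposition: \<open>x = h + \<i> k\<close>, where \<open>h\<close> and
  \<open>k\<close> are built from \<open>x\<close> and its adjoint \<open>y\<close> and have real
  quadratic forms, reduces the claim to the hermitian case.\<close>

lemma positive_map_form:
  assumes x: "x \<in> bounded_operators"
    and \<xi>: "cinner (\<alpha> (vector_projection \<psi>) \<xi>) \<xi> = of_real ((norm \<xi>)\<^sup>2)"
  shows "cinner (\<alpha> x \<xi>) \<xi> = cinner (x \<psi>) \<psi> * of_real ((norm \<xi>)\<^sup>2)"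
proof -
  obtain y where y: "y \<in> bounded_operators" "\<And>u v. cinner (x u) v = cinner u (y v)"
    using adjoint_exists[OF x] by blast
  have yx: "cinner (y v) v = cnj (cinner (x v) v)" for v by (metis cinner_commute y(2))
  define h where "h = (\<lambda>u. (1/2) *\<^sub>C x u + (1/2) *\<^sub>C y u)"
  define k where "k = (\<lambda>u. (- \<i>/2) *\<^sub>C x u + (\<i>/2) *\<^sub>C y u)"
  have hb: "h \<in> bounded_operators" unfolding h_def by (rule bounded_operators_lincomb[OF x y(1)])
  have kb: "k \<in> bounded_operators" unfolding k_def by (rule bounded_operators_lincomb[OF x y(1)])
  have xhk: "x = (\<lambda>u. 1 *\<^sub>C h u + \<i> *\<^sub>C k u)"
  proof
    fix u
    have "1 *\<^sub>C h u + \<i> *\<^sub>C k u = (1/2) *\<^sub>C x u + (1/2) *\<^sub>C x u"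
      by (simp add: h_def k_def scaleC_add_right scaleC_scaleC scaleC_diff_right)
    also have "\<dots> = x u" by (simp flip: scaleC_add_left)
    finally show "x u = 1 *\<^sub>C h u + \<i> *\<^sub>C k u" ..
  qed
  have "cinner (\<alpha> h \<xi>) \<xi> = cinner (h \<psi>) \<psi> * of_real ((norm \<xi>)\<^sup>2)"
    by (rule positive_map_form_hermitian[OF hb _ \<xi>]) (simp add: h_def cinner_simps yx)
  moreover have "cinner (\<alpha> k \<xi>) \<xi> = cinner (k \<psi>) \<psi> * of_real ((norm \<xi>)\<^sup>2)"
    by (rule positive_map_form_hermitian[OF kb _ \<xi>]) (simp add: k_def cinner_simps yx)
  moreover have "\<alpha> x = (\<lambda>u. 1 *\<^sub>C \<alpha> h u + \<i> *\<^sub>C \<alpha> k u)"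
    by (subst xhk) (rule linear_mapD[OF lin hb kb])
  moreover have "cinner (x \<psi>) \<psi> = cinner (h \<psi>) \<psi> + \<i> * cinner (k \<psi>) \<psi>"
    by (subst xhk) (simp add: cinner_simps)
  ultimately show ?thesis by (simp add: cinner_simps algebra_simps)
qed

text \<open>Surjectivity makes each spectral projection an image under \<alpha>, which forces a
  zero-one law for the scalar measure of \<psi>. The second conclusion is what later compares \<psi>
  with other states at the same atom.\<close>

lemma atom_exists:
  assumes "pvm e" and f: "f \<in> borel_measurable borel"
    and A: "spectral_integral e f = (\<lambda>x. Some (\<alpha> (vector_projection \<psi>) x))"
    and inv: "\<And>x. x \<in> bounded_operators \<Longrightarrow> cinner (\<alpha> x \<psi>) \<psi> = cinner (x \<psi>) \<psi>"
    and surj: "\<And>C. C \<in> sets borel \<Longrightarrow> e C \<in> \<alpha> ` bounded_operators"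
  obtains t where "e {t} \<psi> = \<psi>" "\<And>\<xi>. e {t} \<xi> = \<xi> \<Longrightarrow> \<alpha> (vector_projection \<psi>) \<xi> = \<xi>"
proof -
  interpret pvm e by fact
  let ?A = "\<alpha> (vector_projection \<psi>)"
  have inv1: "cinner (?A \<psi>) \<psi> = 1"
    by (simp add: inv vector_projection_bounded cinner_vector_projection cinner_self norm_\<psi>)
  have "norm (e C \<psi>) = 0 \<or> norm (e C \<psi>) = 1" if C: "C \<in> sets borel" for C
  proof -
    have form: "cinner (?A (e C \<psi>)) (e C \<psi>) = cinner (?A \<psi>) (e C \<psi>)" if C: "C \<in> sets borel" for C
    proof -
      have "?A (e C \<psi>) = e C (?A \<psi>)"
        using spectral_integral_commute[OF f C, of \<psi> "?A \<psi>"] by (simp add: A)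
      then show ?thesis using C by (simp add: e_selfadjoint e_idem)
    qed
    have decomp: "\<psi> = e C \<psi> + e (- C) \<psi>" using e_Un[of C "- C" \<psi>] C by simp
    have "Re (cinner (?A \<psi>) (e C \<psi>)) + Re (cinner (?A \<psi>) (e (- C) \<psi>)) = 1"
      using arg_cong[OF inv1, of Re] decomp cinner_add_right[of "?A \<psi>" "e C \<psi>" "e (- C) \<psi>"] by simp
    moreover have "(norm (e C \<psi>))\<^sup>2 + (norm (e (- C) \<psi>))\<^sup>2 = 1"
    proof -
      have "cinner \<psi> \<psi> = cinner (e C \<psi>) \<psi> + cinner (e (- C) \<psi>) \<psi>"
        using decomp by (metis cinner_add_left)
      then have "complex_of_real ((norm (e C \<psi>))\<^sup>2 + (norm (e (- C) \<psi>))\<^sup>2) = of_real 1"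
        using C by (simp add: cinner_self norm_\<psi> cinner_e)
      then show ?thesis by (simp only: of_real_eq_iff)
    qed
    \<comment> \<open>The forms at \<open>e C \<psi>\<close> and \<open>e (- C) \<psi>\<close> sum
      to 1, as do the squared norms, and each form is at most its squared norm; so both inequalities
      are equalities.\<close>
    ultimately have "Re (cinner (?A (e C \<psi>)) (e C \<psi>)) = (norm (e C \<psi>))\<^sup>2"
      using map_vector_projection_le[of "e C \<psi>"] map_vector_projection_le[of "e (- C) \<psi>"] form[of C] form[of "- C"] C
      by simp
    moreover have "positive_operator ?A"
      using pos vector_projection_bounded[of \<psi>] 
      by (auto simp: positive_map_def positive_operator_def cinner_vector_projection)
    ultimately have K: "cinner (?A (e C \<psi>)) (e C \<psi>) = of_real ((norm (e C \<psi>))\<^sup>2)"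
      by (simp add: complex_eq_iff positive_operatorD)
    obtain x where x: "x \<in> bounded_operators" "e C = \<alpha> x" using surj[OF C] by blast
    \<comment> \<open>With \<open>p\<close> the squared norm of \<open>e C \<psi>\<close>, the form
      of \<open>\<alpha> x\<close> at \<open>e C \<psi>\<close> gives
      \<open>p = \<langle>x \<psi>, \<psi>\<rangle> p\<close>, and invariance at \<psi> identifies
      the factor as \<open>p\<close>; thus \<open>p = p\<^sup>2\<close>.\<close>
    have "cinner (e C (e C \<psi>)) (e C \<psi>) = cinner (x \<psi>) \<psi> * of_real ((norm (e C \<psi>))\<^sup>2)"
      using positive_map_form[OF x(1) K] x(2) by simp
    moreover have "cinner (x \<psi>) \<psi> = of_real ((norm (e C \<psi>))\<^sup>2)"
      using inv[OF x(1)] x(2) cinner_e[OF C] by metis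
    ultimately have "complex_of_real ((norm (e C \<psi>))\<^sup>2) = of_real ((norm (e C \<psi>))\<^sup>2 * (norm (e C \<psi>))\<^sup>2)"
      using C by (simp add: e_idem cinner_self)
    then have "(norm (e C \<psi>))\<^sup>2 = (norm (e C \<psi>))\<^sup>2 * (norm (e C \<psi>))\<^sup>2"
      by (simp only: of_real_eq_iff)
    then have "(norm (e C \<psi>))\<^sup>2 = 0 \<or> (norm (e C \<psi>))\<^sup>2 = 1" by (metis mult_cancel_left1)
    then show ?thesis by (smt (verit) norm_ge_zero power2_eq_1_iff zero_eq_power2)
  qed
  then obtain t where t: "e {t} \<psi> = \<psi>" using zero_one_atom norm_\<psi> by blast
  \<comment> \<open>On the range of \<open>e {t}\<close> the operator acts as the scalar
    \<open>f t\<close>, and its form at \<psi> shows that this scalar is 1.\<close>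
  have At: "?A \<xi> = f t *\<^sub>C \<xi>" if "e {t} \<xi> = \<xi>" for \<xi>
    using spectral_integral_atom[OF f that] by (simp add: A)
  then have "f t = 1" using inv1 t by (simp add: cinner_simps cinner_self norm_\<psi>)
  then show ?thesis using that t At by simp
qed

end

section \<open>Comparison of states and a common vector for countably many atoms\<close>

lemma unit_vectors_proportional:
  assumes u: "norm (u::'h::complex_hilbert) = 1" and v: "norm v = 1"
    and 1: "cinner (vector_projection u v) v = 1"
  obtains c where "cmod c = 1" "u = c *\<^sub>C v"
proof -
  have "complex_of_real ((cmod (cinner v u))\<^sup>2) = of_real 1"
    using 1 by (simp only: cinner_vector_projection of_real_1)
  then have sq: "(cmod (cinner v u))\<^sup>2 = 1" by (simp only: of_real_eq_iff)
  have "(cmod (cinner u v))\<^sup>2 = 1" using sq by (metis cinner_commute complex_mod_cnj)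
  moreover have "cinner (compl_projection v u) u = 1 - cinner (vector_projection v u) u"
    by (simp add: compl_projection_def cinner_diff_left cinner_self u)
  \<comment> \<open>Equality case of Cauchy-Schwarz: the component of \<open>u\<close> orthogonal to
    \<open>v\<close> has norm zero.\<close>
  ultimately have "complex_of_real ((norm (compl_projection v u))\<^sup>2) = 0"
    by (simp only: cinner_compl_projection[OF v] cinner_vector_projection) simp
  then have "u = cinner u v *\<^sub>C v" by (simp add: compl_projection_def vector_projection_def)
  moreover have "cmod (cinner u v) = 1"
    using \<open>(cmod (cinner u v))\<^sup>2 = 1\<close> by (smt (verit) norm_ge_zero power2_eq_1_iff)
  ultimately show ?thesis using that by blast
qed

text \<open>Distinct orthonormal vectors have squared distance 2, so points of a countable dense set
  chosen within 1/2 of them are distinct.\<close>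

lemma countable_orthonormal:
  fixes \<psi> :: "'a \<Rightarrow> 'h::real_inner"
  assumes sep: "separable_space (euclidean :: 'h topology)"
    and norm: "\<And>i. i \<in> S \<Longrightarrow> norm (\<psi> i) = 1"
    and orth: "\<And>i j. i \<in> S \<Longrightarrow> j \<in> S \<Longrightarrow> i \<noteq> j \<Longrightarrow> inner (\<psi> i) (\<psi> j) = 0"
  shows "countable S"
proof -
  obtain D :: "'h set" where D: "countable D" "closure D = UNIV"
    using sep by (auto simp: separable_space_def)
  have "\<exists>d\<in>D. dist d (\<psi> i) < 1/2" for i
    using D(2) closure_approachable[of "\<psi> i" D] by (metis UNIV_I half_gt_zero zero_less_one)
  then obtain d where d: "\<And>i. d i \<in> D" "\<And>i. dist (d i) (\<psi> i) < 1/2" by metis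
  have "inj_on d S"
  proof (rule inj_onI, rule ccontr)
    fix i j assume ij: "i \<in> S" "j \<in> S" "d i = d j" "i \<noteq> j"
    have "dist (\<psi> i) (\<psi> j) \<le> dist (d i) (\<psi> i) + dist (d i) (\<psi> j)"
      by (rule dist_triangle3)
    also have "\<dots> < 1" using d(2)[of i] d(2)[of j] ij(3) by simp
    finally have "(norm (\<psi> i - \<psi> j))\<^sup>2 < 1" by (simp add: dist_norm abs_square_less_1)
    moreover have "(norm (\<psi> i - \<psi> j))\<^sup>2 = (norm (\<psi> i))\<^sup>2 + (norm (\<psi> j))\<^sup>2"
      using orth[OF ij(1,2,4)] by (simp add: power2_norm_eq_inner inner_simps inner_commute)
    ultimately show False using ij norm by simp
  qed
  moreover have "countable (d ` S)" using D(1) d(1) by (meson countable_subset image_subsetI)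
  ultimately show ?thesis by (rule countable_image_inj_on[rotated])
qed

text \<open>The geometric weights make the series of the \<psi> vectors converge in norm, and
  \<open>e {t}\<close> annihilates every term except the one belonging to \<open>t\<close>.\<close>

lemma (in pvm) common_vector:
  assumes S: "countable S" and \<psi>: "\<And>t. t \<in> S \<Longrightarrow> norm (\<psi> t) = 1" "\<And>t. t \<in> S \<Longrightarrow> e {t} (\<psi> t) = \<psi> t"
  obtains \<xi> where "\<And>t. t \<in> S \<Longrightarrow> e {t} \<xi> = (1/2) ^ to_nat_on S t *\<^sub>R \<psi> t"
proof -
  \<comment> \<open>Terms outside the range of the enumeration are zero, so finite and infinite
    \<open>S\<close> are handled together.\<close>
  define g where "g n = (if n \<in> to_nat_on S ` S then (1/2)^n *\<^sub>R \<psi> (from_nat_into S n) else 0)" for n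
  have g: "g (to_nat_on S t) = (1/2) ^ to_nat_on S t *\<^sub>R \<psi> t" if "t \<in> S" for t
    using that S by (simp add: g_def)
  have "norm (g n) \<le> (1/2)^n" for n
    using S \<psi>(1) by (auto simp: g_def)
  then have "summable g" by (intro summable_comparison_test'[OF summable_geometric[of "1/2::real"]]) auto
  have "e {t} (suminf g) = (1/2) ^ to_nat_on S t *\<^sub>R \<psi> t" if t: "t \<in> S" for t
  proof -
    have lin: "linear (e {t})" by (rule e_linear) simp
    have "e {t} (g n) = (if n = to_nat_on S t then (1/2) ^ to_nat_on S t *\<^sub>R \<psi> t else 0)" for n
    proof (cases "n \<in> to_nat_on S ` S")
      case True
      then obtain r where r: "r \<in> S" "n = to_nat_on S r" by blast
      have "e {t} (\<psi> r) = 0" if "r \<noteq> t"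
        using e_disjoint[of "{t}" "{r}" "\<psi> r"] that \<psi>(2)[OF r(1)] by simp
      then show ?thesis
        using r g[OF r(1)] S t \<psi>(2)[OF t] by (auto simp: linear_scale[OF lin] inj_on_eq_iff[OF inj_on_to_nat_on[OF S]])
    next
      case False
      then show ?thesis using t by (auto simp: g_def linear_0[OF lin])
    qed
    then have "(\<lambda>n. e {t} (g n)) sums ((1/2) ^ to_nat_on S t *\<^sub>R \<psi> t)"
      using sums_single[of "to_nat_on S t" "\<lambda>_. (1/2) ^ to_nat_on S t *\<^sub>R \<psi> t"] by simp
    moreover have "(\<lambda>n. e {t} (g n)) sums e {t} (suminf g)"
      using \<open>summable g\<close> by (intro bounded_linear.sums[OF e_bounded_linear] summable_sums) auto
    ultimately show ?thesis using sums_unique2 by blast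
  qed
  then show ?thesis by (rule that)
qed

section \<open>From atoms of the spectral measure to weak sufficiency\<close>

theorem theorem7:
  fixes T :: "'h::complex_hilbert \<rightharpoonup> 'h"
    and \<Theta> :: "'i set"
    and \<phi> :: "'i \<Rightarrow> 'h"
    and \<alpha> :: "('h \<Rightarrow> 'h) \<Rightarrow> ('h \<Rightarrow> 'h)"
  assumes "separable_space (euclidean :: 'h topology)"
    and "selfadjoint_operator T"
    and "\<And>\<theta>. \<theta> \<in> \<Theta> \<Longrightarrow> norm (\<phi> \<theta>) = 1"
    and "petz_witness T \<Theta> \<phi> \<alpha>"
    and "\<alpha> ` bounded_operators = generated_algebra T"
  shows "weakly_sufficient T \<Theta> \<phi>"
proof -
  note sep = assms(1) and norm = assms(3) and surj = assms(5)
  have \<alpha>: "linear_map \<alpha>" "positive_map \<alpha>" "unital_map \<alpha>"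
    and inv: "\<And>A \<theta>. A \<in> bounded_operators \<Longrightarrow> \<theta> \<in> \<Theta> \<Longrightarrow>
      cinner (\<alpha> A (\<phi> \<theta>)) (\<phi> \<theta>) = cinner (A (\<phi> \<theta>)) (\<phi> \<theta>)"
    using assms(4) by (auto simp: petz_witness_def)
  define e where "e = (SOME e. is_spectral_measure_of e T)"
  \<comment> \<open>The calculus of an operator without spectral measure is nowhere defined, so it would generate
    the empty algebra, which cannot contain the image of \<open>\<alpha>\<close>.\<close>
  have ex: "\<exists>e. is_spectral_measure_of e T"
  proof (rule ccontr)
    assume "\<not> ?thesis"
    then have "generated_algebra T = {}"
      by (auto simp: generated_algebra_def borel_calculus_def fun_eq_iff)
    then show False using surj bounded_operators_id by blast
  qed
  then have calc: "borel_calculus T f = spectral_integral e f" for f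
    by (simp add: borel_calculus_def e_def)
  have "is_spectral_measure_of e T" unfolding e_def using ex by (rule someI_ex)
  then interpret pvm e by unfold_locales (simp add: is_spectral_measure_of_def)
  \<comment> \<open>Indicators are bounded Borel functions, so spectral projections belong to the
    generated algebra and hence to the image of \<alpha>.\<close>
  have eC: "e C \<in> \<alpha> ` bounded_operators" if C: "C \<in> sets borel" for C
  proof -
    have "borel_calculus T (\<lambda>t. if t \<in> C then 1 else 0) = (\<lambda>x. Some (e C x))"
      by (simp add: calc spectral_integral_indicator[OF C] fun_eq_iff)
    moreover have "bounded (range (\<lambda>t. if t \<in> C then 1 else 0 :: complex))"
      by (rule finite_imp_bounded) (rule finite_subset[of _ "{0, 1}"], auto)
    ultimately show ?thesis unfolding surj generated_algebra_def
      using borel_measurable_simple_function[OF simple_indicator[OF C]] by blast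
  qed
  have "\<exists>t. e {t} (\<phi> \<theta>) = \<phi> \<theta> \<and> (\<forall>\<xi>. e {t} \<xi> = \<xi> \<longrightarrow> \<alpha> (vector_projection (\<phi> \<theta>)) \<xi> = \<xi>)"
    if \<theta>: "\<theta> \<in> \<Theta>" for \<theta>
  proof -
    have "\<alpha> (vector_projection (\<phi> \<theta>)) \<in> generated_algebra T"
      using surj vector_projection_bounded by blast
    then obtain f where "f \<in> borel_measurable borel"
      "spectral_integral e f = (\<lambda>x. Some (\<alpha> (vector_projection (\<phi> \<theta>)) x))"
      by (auto simp: generated_algebra_def calc)
    then show ?thesis
      using atom_exists[OF \<alpha> norm[OF \<theta>] pvm_axioms _ _ inv[OF _ \<theta>] eC] by metis
  qed
  then obtain t where t: "\<And>\<theta>. \<theta> \<in> \<Theta> \<Longrightarrow> e {t \<theta>} (\<phi> \<theta>) = \<phi> \<theta>"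
    and fixed: "\<And>\<theta> \<xi>. \<theta> \<in> \<Theta> \<Longrightarrow> e {t \<theta>} \<xi> = \<xi> \<Longrightarrow> \<alpha> (vector_projection (\<phi> \<theta>)) \<xi> = \<xi>"
    by metis
  \<comment> \<open>Both states sit at the same atom, so the image of the projection onto
    \<open>\<phi> \<theta>'\<close> fixes \<open>\<phi> \<theta>\<close>. Invariance at \<theta>
    then says that the two unit vectors have inner product of modulus 1.\<close>
  have phase: "\<exists>c. cmod c = 1 \<and> \<phi> \<theta>' = c *\<^sub>C \<phi> \<theta>" if \<theta>: "\<theta> \<in> \<Theta>" "\<theta>' \<in> \<Theta>" "t \<theta>' = t \<theta>" for \<theta> \<theta>'
  proof -
    have "\<alpha> (vector_projection (\<phi> \<theta>')) (\<phi> \<theta>) = \<phi> \<theta>"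
      using fixed[OF \<theta>(2)] t[OF \<theta>(1)] \<theta>(3) by simp
    then have "cinner (vector_projection (\<phi> \<theta>') (\<phi> \<theta>)) (\<phi> \<theta>) = 1"
      using inv[OF vector_projection_bounded \<theta>(1)] by (metis cinner_self norm[OF \<theta>(1)] of_real_1 one_power2)
    then show ?thesis using unit_vectors_proportional[OF norm[OF \<theta>(2)] norm[OF \<theta>(1)]] by metis
  qed
  define S where "S = t ` \<Theta>"
  \<comment> \<open>One parameter is chosen for each atom; all other states at that atom differ from
    the chosen one by a phase.\<close>
  define rep where "rep = inv_into \<Theta> t"
  have rep: "rep s \<in> \<Theta>" "t (rep s) = s" if "s \<in> S" for s
    using that by (auto simp: rep_def S_def inv_into_into f_inv_into_f)
  define \<psi> where "\<psi> s = \<phi> (rep s)" for s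
  have \<psi>: "norm (\<psi> s) = 1" "e {s} (\<psi> s) = \<psi> s" if "s \<in> S" for s
    using rep[OF that] norm t by (auto simp: \<psi>_def) metis
  have S: "countable S"
  proof (rule countable_orthonormal[OF sep \<psi>(1)])
    fix r s assume "r \<in> S" "s \<in> S" "r \<noteq> s"
    \<comment> \<open>Vectors fixed by the projections of two different points are
      orthogonal.\<close>
    have "cinner (\<psi> r) (\<psi> s) = cinner (\<psi> r) (e {r} (e {s} (\<psi> s)))"
      using \<psi>(2)[OF \<open>s \<in> S\<close>] \<psi>(2)[OF \<open>r \<in> S\<close>] e_selfadjoint[of "{r}" "\<psi> r" "\<psi> s"] by simp
    also have "\<dots> = 0" using \<open>r \<noteq> s\<close> by (simp add: e_disjoint)
    finally show "inner (\<psi> r) (\<psi> s) = 0" by (simp flip: Re_cinner)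
  qed
  obtain \<xi> where \<xi>: "\<And>s. s \<in> S \<Longrightarrow> e {s} \<xi> = (1/2) ^ to_nat_on S s *\<^sub>R \<psi> s"
    using common_vector[OF S \<psi>] by blast
  \<comment> \<open>The phase is taken in the direction in which the representative is the required
    version of \<open>\<phi> \<theta>\<close>.\<close>
  have "\<exists>c. cmod c = 1 \<and> \<psi> (t \<theta>) = c *\<^sub>C \<phi> \<theta>" if "\<theta> \<in> \<Theta>" for \<theta>
    unfolding \<psi>_def using that by (intro phase) (auto simp: S_def intro!: rep)
  then obtain c where c: "\<And>\<theta>. \<theta> \<in> \<Theta> \<Longrightarrow> cmod (c \<theta>) = 1 \<and> \<psi> (t \<theta>) = c \<theta> *\<^sub>C \<phi> \<theta>" by metis
  \<comment> \<open>The power of 2 cancels the weight that the common vector carries at the atom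
    \<open>t \<theta>\<close>; the singleton membership matches the form of
    \<open>spectral_integral_indicator\<close>.\<close>
  define \<Phi> :: "'i \<Rightarrow> real \<Rightarrow> real" where
    "\<Phi> \<theta> s = (if s \<in> {t \<theta>} then 2 ^ to_nat_on S (t \<theta>) else 0)" for \<theta> s
  have "borel_calculus T (\<lambda>s. complex_of_real (\<Phi> \<theta> s)) \<xi> = Some (c \<theta> *\<^sub>C \<phi> \<theta>)" if \<theta>: "\<theta> \<in> \<Theta>" for \<theta>
  proof -
    let ?n = "to_nat_on S (t \<theta>)"
    have "(\<lambda>s. complex_of_real (\<Phi> \<theta> s)) = (\<lambda>s. if s \<in> {t \<theta>} then of_real (2 ^ ?n) else 0)"
      by (auto simp: \<Phi>_def)
    then have "borel_calculus T (\<lambda>s. complex_of_real (\<Phi> \<theta> s)) \<xi> = Some (of_real (2 ^ ?n) *\<^sub>C e {t \<theta>} \<xi>)"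
      unfolding calc using spectral_integral_indicator[of "{t \<theta>}"] by (simp only:) simp
    also have "of_real (2 ^ ?n) *\<^sub>C e {t \<theta>} \<xi> = \<psi> (t \<theta>)"
      unfolding scaleC_of_real using \<xi>[of "t \<theta>"] \<theta> by (simp add: S_def flip: power_mult_distrib)
    finally show ?thesis using c[OF \<theta>] by simp
  qed
  moreover have "\<Phi> \<theta> \<in> borel_measurable borel" for \<theta>
    unfolding \<Phi>_def by measurable
  ultimately show ?thesis unfolding weakly_sufficient_def using c by blast
qed

end
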